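(* Let $\mathcal{M}$ be an object of $\mathcal{M}on_{\rm nul}$, $\mathcal{A}$ a Grothendieck category and $n\in\mathbb{N}$. A functor $\mathcal{M}\to\mathcal{A}$ is weakly polynomial of degree $n$ if and only if it is strongly polynomial of degree $n$.
   Context: $\mathcal{M}on_{\rm nul}$ is the category of small strict symmetric monoidal categories $(\mathcal{M},\oplus,0)$ whose unit $0$ is a null object (in particular initial). For a small strict symmetric monoidal category $(\mathcal{M},\oplus,0)$ with $0$ initial: $\mathbf{Fct}(\mathcal{M},\mathcal{A})$ is the category of functors $\mathcal{M}\to\mathcal{A}$; for an object $x$ of $\mathcal{M}$, $\tau_x$ is precomposition with $x\oplus-$; $\kappa_x(F)$ and $\delta_x(F)$ are the kernel and cokernel of the map $F=\tau_0(F)\to\tau_x(F)$ induced by the unique morphism $0\to x$. Strong polynomiality: the full subcategories $\mathcal{P}ol_n^{\rm fort}(\mathcal{M},\mathcal{A})$ of $\mathbf{Fct}(\mathcal{M},\mathcal{A})$ are defined inductively: $\{0\}$ for $n<0$; for $n\ge0$, the functors $F$ such that $\delta_x(F)\in\mathcal{P}ol^{\rm fort}_{n-1}(\mathcal{M},\mathcal{A})$ for all objects $x$ of $\mathcal{M}$. $F$ is strongly polynomial if it belongs to $\mathcal{P}ol_n^{\rm fort}(\mathcal{M},\mathcal{A})$ for some $n$; its (strong) degree is the minimum in $\mathbb{N}\cup\{\infty\}$ of these $n$. Weak polynomiality: $F$ is stably null if $\sum_x\kappa_x(F)=F$, the sum being over all objects $x$ of $\mathcal{M}$. The stably null functors form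 a thick subcategory $\mathcal{S}n(\mathcal{M},\mathcal{A})$ of $\mathbf{Fct}(\mathcal{M},\mathcal{A})$, stable under colimits; $\mathbf{St}(\mathcal{M},\mathcal{A})$ is the quotient category $\mathbf{Fct}(\mathcal{M},\mathcal{A})/\mathcal{S}n(\mathcal{M},\mathcal{A})$, on which $\delta_x$ induces an endofunctor, still denoted $\delta_x$. The full subcategories $\mathcal{P}ol_n(\mathcal{M},\mathcal{A})$ of $\mathbf{St}(\mathcal{M},\mathcal{A})$ are defined inductively: $\{0\}$ for $n<0$; for $n\ge0$, the objects $X$ such that $\delta_x(X)\in\mathcal{P}ol_{n-1}(\mathcal{M},\mathcal{A})$ for all objects $x$ of $\mathcal{M}$. An object of $\mathbf{St}(\mathcal{M},\mathcal{A})$ is polynomial if it belongs to some $\mathcal{P}ol_n(\mathcal{M},\mathcal{A})$; its degree is the smallest $n\in\mathbb{N}\cup\{-\infty\}$ for which this happens. A functor $F$ is weakly polynomial if its image in $\mathbf{St}(\mathcal{M},\mathcal{A})$ is polynomial; its (weak) degree is the degree of this image, so that $F$ has weak degree at most $n$ when its image belongs to $\mathcal{P}ol_n(\mathcal{M},\mathcal{A})$.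
   Formalization: The equivalence for degree exactly n excludes the null functor with n = 0, which has strong degree 0 but weak degree −∞, so the literal claim fails there; the equivalence for degree at most n is stated without exception. *)

theory Defs
  imports "HOL-Algebra.Group" "HOL-Library.Equipollence" "HOL-Library.Extended_Real"
begin

section \<open>Categories\<close>

record ('o, 'a) cat =
  Obj :: "'o set"
  Arr :: "'a set"
  Dom :: "'a \<Rightarrow> 'o"
  Cod :: "'a \<Rightarrow> 'o"
  Id  :: "'o \<Rightarrow> 'a"
  Comp :: "'a \<Rightarrow> 'a \<Rightarrow> 'a"  (infixl "\<cdot>\<index>" 70)

definition Hom :: "('o, 'a, 'z) cat_scheme \<Rightarrow> 'o \<Rightarrow> 'o \<Rightarrow> 'a set" where
  "Hom C X Y = {f \<in> Arr C. Dom C f = X \<and> Cod C f = Y}"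

locale category =
  fixes C :: "('o, 'a, 'z) cat_scheme" (structure)
  assumes dom_obj: "f \<in> Arr C \<Longrightarrow> Dom C f \<in> Obj C"
    and cod_obj: "f \<in> Arr C \<Longrightarrow> Cod C f \<in> Obj C"
    and id_hom: "X \<in> Obj C \<Longrightarrow> Id C X \<in> Hom C X X"
    and comp_hom: "f \<in> Hom C X Y \<Longrightarrow> g \<in> Hom C Y Z \<Longrightarrow> g \<cdot> f \<in> Hom C X Z"
    and comp_id: "f \<in> Hom C X Y \<Longrightarrow> f \<cdot> Id C X = f"
    and id_comp: "f \<in> Hom C X Y \<Longrightarrow> Id C Y \<cdot> f = f"
    and comp_assoc:
      "f \<in> Hom C W X \<Longrightarrow> g \<in> Hom C X Y \<Longrightarrow> h \<in> Hom C Y Z \<Longrightarrow> (h \<cdot> g) \<cdot> f = h \<cdot> (g \<cdot> f)"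

definition initial_object :: "('o, 'a, 'z) cat_scheme \<Rightarrow> 'o \<Rightarrow> bool" where
  "initial_object C X \<longleftrightarrow> X \<in> Obj C \<and> (\<forall>Y\<in>Obj C. \<exists>!f. f \<in> Hom C X Y)"

definition terminal_object :: "('o, 'a, 'z) cat_scheme \<Rightarrow> 'o \<Rightarrow> bool" where
  "terminal_object C X \<longleftrightarrow> X \<in> Obj C \<and> (\<forall>Y\<in>Obj C. \<exists>!f. f \<in> Hom C Y X)"

definition null_object :: "('o, 'a, 'z) cat_scheme \<Rightarrow> 'o \<Rightarrow> bool" where
  "null_object C X \<longleftrightarrow> initial_object C X \<and> terminal_object C X"

definition zero_arrow :: "('o, 'a, 'z) cat_scheme \<Rightarrow> 'a \<Rightarrow> bool" where
  "zero_arrow C f \<longleftrightarrow> f \<in> Arr C \<and>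
    (\<exists>Z g h. null_object C Z \<and> g \<in> Hom C (Dom C f) Z \<and> h \<in> Hom C Z (Cod C f) \<and> f = h \<cdot>\<^bsub>C\<^esub> g)"

definition monic :: "('o, 'a, 'z) cat_scheme \<Rightarrow> 'a \<Rightarrow> bool" where
  "monic C f \<longleftrightarrow> f \<in> Arr C \<and>
    (\<forall>X. \<forall>u\<in>Hom C X (Dom C f). \<forall>v\<in>Hom C X (Dom C f). f \<cdot>\<^bsub>C\<^esub> u = f \<cdot>\<^bsub>C\<^esub> v \<longrightarrow> u = v)"

definition epic :: "('o, 'a, 'z) cat_scheme \<Rightarrow> 'a \<Rightarrow> bool" where
  "epic C f \<longleftrightarrow> f \<in> Arr C \<and>
    (\<forall>Y. \<forall>u\<in>Hom C (Cod C f) Y. \<forall>v\<in>Hom C (Cod C f) Y. u \<cdot>\<^bsub>C\<^esub> f = v \<cdot>\<^bsub>C\<^esub> f \<longrightarrow> u = v)"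

definition is_kernel :: "('o, 'a, 'z) cat_scheme \<Rightarrow> 'a \<Rightarrow> 'a \<Rightarrow> bool" where
  "is_kernel C f k \<longleftrightarrow> k \<in> Arr C \<and> Cod C k = Dom C f \<and> zero_arrow C (f \<cdot>\<^bsub>C\<^esub> k) \<and>
    (\<forall>h\<in>Arr C. Cod C h = Dom C f \<and> zero_arrow C (f \<cdot>\<^bsub>C\<^esub> h) \<longrightarrow>
      (\<exists>!u. u \<in> Hom C (Dom C h) (Dom C k) \<and> k \<cdot>\<^bsub>C\<^esub> u = h))"

definition is_cokernel :: "('o, 'a, 'z) cat_scheme \<Rightarrow> 'a \<Rightarrow> 'a \<Rightarrow> bool" where
  "is_cokernel C f c \<longleftrightarrow> c \<in> Arr C \<and> Dom C c = Cod C f \<and> zero_arrow C (c \<cdot>\<^bsub>C\<^esub> f) \<and>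
    (\<forall>h\<in>Arr C. Dom C h = Cod C f \<and> zero_arrow C (h \<cdot>\<^bsub>C\<^esub> f) \<longrightarrow>
      (\<exists>!u. u \<in> Hom C (Cod C c) (Cod C h) \<and> u \<cdot>\<^bsub>C\<^esub> c = h))"

definition short_exact :: "('o, 'a, 'z) cat_scheme \<Rightarrow> 'a \<Rightarrow> 'a \<Rightarrow> bool" where
  "short_exact C f g \<longleftrightarrow> is_kernel C g f \<and> is_cokernel C f g"

definition is_product :: "('o, 'a, 'z) cat_scheme \<Rightarrow> 'o \<Rightarrow> 'o \<Rightarrow> 'o \<Rightarrow> 'a \<Rightarrow> 'a \<Rightarrow> bool" where
  "is_product C X Y P p q \<longleftrightarrow> P \<in> Obj C \<and> p \<in> Hom C P X \<and> q \<in> Hom C P Y \<and>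
    (\<forall>W. \<forall>f\<in>Hom C W X. \<forall>g\<in>Hom C W Y.
      \<exists>!u. u \<in> Hom C W P \<and> p \<cdot>\<^bsub>C\<^esub> u = f \<and> q \<cdot>\<^bsub>C\<^esub> u = g)"

definition factors_through :: "('o, 'a, 'z) cat_scheme \<Rightarrow> 'a \<Rightarrow> 'a \<Rightarrow> bool" where
  "factors_through C k s \<longleftrightarrow> (\<exists>u. u \<in> Hom C (Dom C k) (Dom C s) \<and> s \<cdot>\<^bsub>C\<^esub> u = k)"

text \<open>The sum of a set \<open>K\<close> of subobjects of \<open>X\<close>, i.e. their supremum among the subobjects of
  \<open>X\<close>; subobjects are represented by monomorphisms with codomain \<open>X\<close>.\<close>

definition is_subobject_sum :: "('o, 'a, 'z) cat_scheme \<Rightarrow> 'o \<Rightarrow> 'a set \<Rightarrow> 'a \<Rightarrow> bool" where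
  "is_subobject_sum C X K s \<longleftrightarrow> monic C s \<and> Cod C s = X \<and> (\<forall>k\<in>K. factors_through C k s) \<and>
    (\<forall>t. monic C t \<and> Cod C t = X \<and> (\<forall>k\<in>K. factors_through C k t) \<longrightarrow> factors_through C s t)"


section \<open>Functor categories\<close>

text \<open>Functors and natural transformations are taken to be \<^const>\<open>undefined\<close> outside the source
  category, so that equality in HOL is equality of functors, resp. of natural transformations.\<close>

record ('o, 'a, 'p, 'b) cfunctor =
  fob :: "'o \<Rightarrow> 'p"
  far :: "'a \<Rightarrow> 'b"

record ('o, 'a, 'p, 'b) ntrans =
  ndom :: "('o, 'a, 'p, 'b) cfunctor"
  ncod :: "('o, 'a, 'p, 'b) cfunctor"
  ncomp :: "'o \<Rightarrow> 'b"

definition functors ::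
  "('o, 'a, 'y) cat_scheme \<Rightarrow> ('p, 'b, 'z) cat_scheme \<Rightarrow> ('o, 'a, 'p, 'b) cfunctor set" where
  "functors M A = {F. fob F \<in> extensional (Obj M) \<and> far F \<in> extensional (Arr M) \<and>
    (\<forall>x\<in>Obj M. fob F x \<in> Obj A) \<and>
    (\<forall>x\<in>Obj M. \<forall>y\<in>Obj M. \<forall>f\<in>Hom M x y. far F f \<in> Hom A (fob F x) (fob F y)) \<and>
    (\<forall>x\<in>Obj M. far F (Id M x) = Id A (fob F x)) \<and>
    (\<forall>x\<in>Obj M. \<forall>y\<in>Obj M. \<forall>z\<in>Obj M. \<forall>f\<in>Hom M x y. \<forall>g\<in>Hom M y z.
      far F (g \<cdot>\<^bsub>M\<^esub> f) = far F g \<cdot>\<^bsub>A\<^esub> far F f)}"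

definition ntranss ::
  "('o, 'a, 'y) cat_scheme \<Rightarrow> ('p, 'b, 'z) cat_scheme \<Rightarrow> ('o, 'a, 'p, 'b) ntrans set" where
  "ntranss M A = {\<eta>. ndom \<eta> \<in> functors M A \<and> ncod \<eta> \<in> functors M A \<and>
    ncomp \<eta> \<in> extensional (Obj M) \<and>
    (\<forall>x\<in>Obj M. ncomp \<eta> x \<in> Hom A (fob (ndom \<eta>) x) (fob (ncod \<eta>) x)) \<and>
    (\<forall>x\<in>Obj M. \<forall>y\<in>Obj M. \<forall>f\<in>Hom M x y.
      ncomp \<eta> y \<cdot>\<^bsub>A\<^esub> far (ndom \<eta>) f = far (ncod \<eta>) f \<cdot>\<^bsub>A\<^esub> ncomp \<eta> x)}"

definition Fct :: "('o, 'a, 'y) cat_scheme \<Rightarrow> ('p, 'b, 'z) cat_scheme \<Rightarrow>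
    (('o, 'a, 'p, 'b) cfunctor, ('o, 'a, 'p, 'b) ntrans) cat" where
  "Fct M A = \<lparr>
    Obj = functors M A,
    Arr = ntranss M A,
    Dom = ndom,
    Cod = ncod,
    Id = (\<lambda>F. \<lparr>ndom = F, ncod = F, ncomp = (\<lambda>x\<in>Obj M. Id A (fob F x))\<rparr>),
    Comp = (\<lambda>\<theta> \<eta>. \<lparr>ndom = ndom \<eta>, ncod = ncod \<theta>,
                    ncomp = (\<lambda>x\<in>Obj M. ncomp \<theta> x \<cdot>\<^bsub>A\<^esub> ncomp \<eta> x)\<rparr>)\<rparr>"


section \<open>Grothendieck categories\<close>

definition preadditive :: "('o, 'a, 'z) cat_scheme \<Rightarrow> bool" where
  "preadditive C \<longleftrightarrow> (\<exists>add zero.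
    (\<forall>X\<in>Obj C. \<forall>Y\<in>Obj C. comm_group \<lparr>carrier = Hom C X Y, mult = add, one = zero X Y\<rparr>) \<and>
    (\<forall>X\<in>Obj C. \<forall>Y\<in>Obj C. \<forall>Z\<in>Obj C.
      \<forall>f\<in>Hom C X Y. \<forall>f'\<in>Hom C X Y. \<forall>g\<in>Hom C Y Z. \<forall>g'\<in>Hom C Y Z.
        g \<cdot>\<^bsub>C\<^esub> add f f' = add (g \<cdot>\<^bsub>C\<^esub> f) (g \<cdot>\<^bsub>C\<^esub> f') \<and>
        add g g' \<cdot>\<^bsub>C\<^esub> f = add (g \<cdot>\<^bsub>C\<^esub> f) (g' \<cdot>\<^bsub>C\<^esub> f)))"

definition abelian_category :: "('o, 'a, 'z) cat_scheme \<Rightarrow> bool" where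
  "abelian_category C \<longleftrightarrow> category C \<and> preadditive C \<and>
    (\<exists>Z. null_object C Z) \<and>
    (\<forall>X\<in>Obj C. \<forall>Y\<in>Obj C. \<exists>P p q. is_product C X Y P p q) \<and>
    (\<forall>f\<in>Arr C. \<exists>k. is_kernel C f k) \<and>
    (\<forall>f\<in>Arr C. \<exists>c. is_cokernel C f c) \<and>
    (\<forall>f. monic C f \<longrightarrow> (\<exists>g\<in>Arr C. is_kernel C g f)) \<and>
    (\<forall>f. epic C f \<longrightarrow> (\<exists>g\<in>Arr C. is_cokernel C g f))"

definition is_cocone :: "('j, 'k, 'y) cat_scheme \<Rightarrow> ('o, 'a, 'z) cat_scheme \<Rightarrow>
    ('j, 'k, 'o, 'a) cfunctor \<Rightarrow> 'o \<Rightarrow> ('j \<Rightarrow> 'a) \<Rightarrow> bool" where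
  "is_cocone J C D L c \<longleftrightarrow> L \<in> Obj C \<and> (\<forall>i\<in>Obj J. c i \<in> Hom C (fob D i) L) \<and>
    (\<forall>i\<in>Obj J. \<forall>j\<in>Obj J. \<forall>f\<in>Hom J i j. c j \<cdot>\<^bsub>C\<^esub> far D f = c i)"

definition is_colimit :: "('j, 'k, 'y) cat_scheme \<Rightarrow> ('o, 'a, 'z) cat_scheme \<Rightarrow>
    ('j, 'k, 'o, 'a) cfunctor \<Rightarrow> 'o \<Rightarrow> ('j \<Rightarrow> 'a) \<Rightarrow> bool" where
  "is_colimit J C D L c \<longleftrightarrow> is_cocone J C D L c \<and>
    (\<forall>L' c'. is_cocone J C D L' c' \<longrightarrow>
      (\<exists>!u. u \<in> Hom C L L' \<and> (\<forall>i\<in>Obj J. u \<cdot>\<^bsub>C\<^esub> c i = c' i)))"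

definition filtered :: "('j, 'k, 'y) cat_scheme \<Rightarrow> bool" where
  "filtered J \<longleftrightarrow> Obj J \<noteq> {} \<and>
    (\<forall>i\<in>Obj J. \<forall>j\<in>Obj J. \<exists>k\<in>Obj J. Hom J i k \<noteq> {} \<and> Hom J j k \<noteq> {}) \<and>
    (\<forall>i\<in>Obj J. \<forall>j\<in>Obj J. \<forall>f\<in>Hom J i j. \<forall>g\<in>Hom J i j.
      \<exists>k\<in>Obj J. \<exists>h\<in>Hom J j k. h \<cdot>\<^bsub>J\<^esub> f = h \<cdot>\<^bsub>J\<^esub> g)"

text \<open>The type \<open>'u\<close> fixes what \<^emph>\<open>small\<close> means: a set is small if it injects into \<open>'u\<close>. Up to
  isomorphism, the small categories are those of type \<open>('u, 'u) cat\<close>, which serve as the shapes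
  of the small diagrams. (A category whose arrows form a set in HOL cannot have coproducts indexed
  by all sets unless it is a preorder, so a bound on the diagrams is unavoidable.) Hom-sets are
  not required to be small in this sense: with coproducts indexed by \<open>'u\<close> they would have to be
  singletons, because \<open>'u\<close> is a fixed set and not a universe closed under power sets.\<close>

definition cocomplete :: "'u itself \<Rightarrow> ('o, 'a, 'z) cat_scheme \<Rightarrow> bool" where
  "cocomplete _ C \<longleftrightarrow> (\<forall>(J :: ('u, 'u) cat) D. category J \<and> D \<in> functors J C \<longrightarrow>
    (\<exists>L c. is_colimit J C D L c))"

definition exact_filtered_colimits :: "'u itself \<Rightarrow> ('o, 'a, 'z) cat_scheme \<Rightarrow> bool" where
  "exact_filtered_colimits _ C \<longleftrightarrow>
    (\<forall>(J :: ('u, 'u) cat) \<alpha> \<beta> L c L' c' L'' c'' a b.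
      category J \<and> filtered J \<and>
      \<alpha> \<in> ntranss J C \<and> \<beta> \<in> ntranss J C \<and> ncod \<alpha> = ndom \<beta> \<and>
      (\<forall>i\<in>Obj J. short_exact C (ncomp \<alpha> i) (ncomp \<beta> i)) \<and>
      is_colimit J C (ndom \<alpha>) L c \<and> is_colimit J C (ndom \<beta>) L' c' \<and>
      is_colimit J C (ncod \<beta>) L'' c'' \<and>
      a \<in> Hom C L L' \<and> (\<forall>i\<in>Obj J. a \<cdot>\<^bsub>C\<^esub> c i = c' i \<cdot>\<^bsub>C\<^esub> ncomp \<alpha> i) \<and>
      b \<in> Hom C L' L'' \<and> (\<forall>i\<in>Obj J. b \<cdot>\<^bsub>C\<^esub> c' i = c'' i \<cdot>\<^bsub>C\<^esub> ncomp \<beta> i) \<longrightarrow>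
      short_exact C a b)"

definition is_generator :: "('o, 'a, 'z) cat_scheme \<Rightarrow> 'o \<Rightarrow> bool" where
  "is_generator C G \<longleftrightarrow> G \<in> Obj C \<and>
    (\<forall>X\<in>Obj C. \<forall>Y\<in>Obj C. \<forall>f\<in>Hom C X Y. \<forall>g\<in>Hom C X Y.
      f \<noteq> g \<longrightarrow> (\<exists>h\<in>Hom C G X. f \<cdot>\<^bsub>C\<^esub> h \<noteq> g \<cdot>\<^bsub>C\<^esub> h))"

definition grothendieck_category :: "'u itself \<Rightarrow> ('o, 'a, 'z) cat_scheme \<Rightarrow> bool" where
  "grothendieck_category U C \<longleftrightarrow> infinite (UNIV :: 'u set) \<and> abelian_category C \<and>
    cocomplete U C \<and> exact_filtered_colimits U C \<and> (\<exists>G. is_generator C G)"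


section \<open>Quotients by thick subcategories\<close>

text \<open>The quotient of an abelian category \<open>C\<close> by a thick subcategory with set of objects \<open>S\<close> is the
  localization of \<open>C\<close> at the arrows whose kernel and cokernel lie in \<open>S\<close>. These arrows admit a
  calculus of fractions: an arrow from \<open>X\<close> to \<open>Y\<close> in the quotient is a class of roofs
  \<open>X \<leftarrow> X' \<rightarrow> Y\<close>, represented as pairs, whose first leg is such an arrow.\<close>

definition iso_mod :: "('o, 'a, 'z) cat_scheme \<Rightarrow> 'o set \<Rightarrow> 'a set" where
  "iso_mod C S = {s \<in> Arr C. (\<exists>k. is_kernel C s k \<and> Dom C k \<in> S) \<and>
                             (\<exists>c. is_cokernel C s c \<and> Cod C c \<in> S)}"

definition roofs :: "('o, 'a, 'z) cat_scheme \<Rightarrow> 'o set \<Rightarrow> 'o \<Rightarrow> 'o \<Rightarrow> ('a \<times> 'a) set" where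
  "roofs C S X Y = {(s, f). s \<in> iso_mod C S \<and> f \<in> Arr C \<and> Dom C s = Dom C f \<and>
                            Cod C s = X \<and> Cod C f = Y}"

definition roof_equiv ::
  "('o, 'a, 'z) cat_scheme \<Rightarrow> 'o set \<Rightarrow> 'o \<Rightarrow> 'o \<Rightarrow> (('a \<times> 'a) \<times> ('a \<times> 'a)) set" where
  "roof_equiv C S X Y = {((s, f), (t, g)). (s, f) \<in> roofs C S X Y \<and> (t, g) \<in> roofs C S X Y \<and>
    (\<exists>W u v. u \<in> Hom C W (Dom C s) \<and> v \<in> Hom C W (Dom C t) \<and>
      s \<cdot>\<^bsub>C\<^esub> u = t \<cdot>\<^bsub>C\<^esub> v \<and> s \<cdot>\<^bsub>C\<^esub> u \<in> iso_mod C S \<and> f \<cdot>\<^bsub>C\<^esub> u = g \<cdot>\<^bsub>C\<^esub> v)}"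

definition roof_class ::
  "('o, 'a, 'z) cat_scheme \<Rightarrow> 'o set \<Rightarrow> 'a \<times> 'a \<Rightarrow> ('a \<times> 'a) set" where
  "roof_class C S r = roof_equiv C S (Cod C (fst r)) (Cod C (snd r)) `` {r}"

text \<open>In the composition below, and in \<open>induced_functor\<close>, the set being united consists of a
  single class whenever the operation is well defined; the union extracts it.\<close>

definition quotient_cat :: "('o, 'a, 'z) cat_scheme \<Rightarrow> 'o set \<Rightarrow>
    ('o, 'o \<times> 'o \<times> ('a \<times> 'a) set) cat" where
  "quotient_cat C S = \<lparr>
    Obj = Obj C,
    Arr = {(X, Y, R). X \<in> Obj C \<and> Y \<in> Obj C \<and> R \<in> roofs C S X Y // roof_equiv C S X Y},
    Dom = (\<lambda>(X, Y, R). X),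
    Cod = (\<lambda>(X, Y, R). Y),
    Id = (\<lambda>X. (X, X, roof_class C S (Id C X, Id C X))),
    Comp = (\<lambda>(_, Z, R') (X, _, R). (X, Z,
      \<Union> {roof_class C S (s \<cdot>\<^bsub>C\<^esub> u, g \<cdot>\<^bsub>C\<^esub> v) | s f t g u v W.
          (s, f) \<in> R \<and> (t, g) \<in> R' \<and> u \<in> iso_mod C S \<and> u \<in> Hom C W (Dom C f) \<and>
          v \<in> Hom C W (Dom C t) \<and> f \<cdot>\<^bsub>C\<^esub> u = t \<cdot>\<^bsub>C\<^esub> v}))\<rparr>"

definition quotient_functor :: "('o, 'a, 'z) cat_scheme \<Rightarrow> 'o set \<Rightarrow>
    ('o, 'a, 'o, 'o \<times> 'o \<times> ('a \<times> 'a) set) cfunctor" where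
  "quotient_functor C S = \<lparr>
    fob = (\<lambda>X\<in>Obj C. X),
    far = (\<lambda>f\<in>Arr C. (Dom C f, Cod C f, roof_class C S (Id C (Dom C f), f)))\<rparr>"

text \<open>The endofunctor of the quotient induced by an endofunctor \<open>T\<close> of \<open>C\<close>.\<close>

definition induced_functor :: "('o, 'a, 'z) cat_scheme \<Rightarrow> 'o set \<Rightarrow> ('o, 'a, 'o, 'a) cfunctor \<Rightarrow>
    ('o, 'o \<times> 'o \<times> ('a \<times> 'a) set, 'o, 'o \<times> 'o \<times> ('a \<times> 'a) set) cfunctor" where
  "induced_functor C S T = \<lparr>
    fob = (\<lambda>X\<in>Obj (quotient_cat C S). fob T X),
    far = (\<lambda>(X, Y, R)\<in>Arr (quotient_cat C S).
      (fob T X, fob T Y, \<Union> {roof_class C S (far T s, far T f) | s f. (s, f) \<in> R}))\<rparr>"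


section \<open>Symmetric monoidal categories\<close>

record ('o, 'a) moncat = "('o, 'a) cat" +
  oplus :: "'o \<Rightarrow> 'o \<Rightarrow> 'o"
  aplus :: "'a \<Rightarrow> 'a \<Rightarrow> 'a"
  unit_obj :: 'o
  symm :: "'o \<Rightarrow> 'o \<Rightarrow> 'a"

text \<open>Strict means that associativity and unitality hold on the nose, on objects and on arrows; the
  symmetry need not be an identity.\<close>

locale strict_symmetric_monoidal = category M
  for M :: "('o, 'a, 'z) moncat_scheme" (structure) +
  assumes oplus_obj: "x \<in> Obj M \<Longrightarrow> y \<in> Obj M \<Longrightarrow> oplus M x y \<in> Obj M"
    and aplus_hom: "f \<in> Hom M x y \<Longrightarrow> f' \<in> Hom M x' y' \<Longrightarrow>
      aplus M f f' \<in> Hom M (oplus M x x') (oplus M y y')"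
    and aplus_id: "x \<in> Obj M \<Longrightarrow> y \<in> Obj M \<Longrightarrow> aplus M (Id M x) (Id M y) = Id M (oplus M x y)"
    and aplus_comp:
      "f \<in> Hom M x y \<Longrightarrow> g \<in> Hom M y z \<Longrightarrow> f' \<in> Hom M x' y' \<Longrightarrow> g' \<in> Hom M y' z' \<Longrightarrow>
        aplus M (g \<cdot> f) (g' \<cdot> f') = aplus M g g' \<cdot> aplus M f f'"
    and unit_obj: "unit_obj M \<in> Obj M"
    and oplus_assoc: "x \<in> Obj M \<Longrightarrow> y \<in> Obj M \<Longrightarrow> z \<in> Obj M \<Longrightarrow>
      oplus M (oplus M x y) z = oplus M x (oplus M y z)"
    and oplus_unit_left: "x \<in> Obj M \<Longrightarrow> oplus M (unit_obj M) x = x"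
    and oplus_unit_right: "x \<in> Obj M \<Longrightarrow> oplus M x (unit_obj M) = x"
    and aplus_assoc: "f \<in> Arr M \<Longrightarrow> g \<in> Arr M \<Longrightarrow> h \<in> Arr M \<Longrightarrow>
      aplus M (aplus M f g) h = aplus M f (aplus M g h)"
    and aplus_unit_left: "f \<in> Arr M \<Longrightarrow> aplus M (Id M (unit_obj M)) f = f"
    and aplus_unit_right: "f \<in> Arr M \<Longrightarrow> aplus M f (Id M (unit_obj M)) = f"
    and symm_hom: "x \<in> Obj M \<Longrightarrow> y \<in> Obj M \<Longrightarrow> symm M x y \<in> Hom M (oplus M x y) (oplus M y x)"
    and symm_nat: "f \<in> Hom M x y \<Longrightarrow> f' \<in> Hom M x' y' \<Longrightarrow>
      symm M y y' \<cdot> aplus M f f' = aplus M f' f \<cdot> symm M x x'"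
    and symm_inv: "x \<in> Obj M \<Longrightarrow> y \<in> Obj M \<Longrightarrow> symm M y x \<cdot> symm M x y = Id M (oplus M x y)"
    and symm_hexagon: "x \<in> Obj M \<Longrightarrow> y \<in> Obj M \<Longrightarrow> z \<in> Obj M \<Longrightarrow>
      symm M x (oplus M y z) = aplus M (Id M y) (symm M x z) \<cdot> aplus M (symm M x y) (Id M z)"
    and symm_unit: "x \<in> Obj M \<Longrightarrow> symm M x (unit_obj M) = Id M x"

definition small_cat :: "'u itself \<Rightarrow> ('o, 'a, 'z) cat_scheme \<Rightarrow> bool" where
  "small_cat _ C \<longleftrightarrow> Obj C \<lesssim> (UNIV :: 'u set) \<and> Arr C \<lesssim> (UNIV :: 'u set)"

definition Mon_nul :: "'u itself \<Rightarrow> ('o, 'a, 'z) moncat_scheme \<Rightarrow> bool" where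
  "Mon_nul U M \<longleftrightarrow>
    strict_symmetric_monoidal M \<and> small_cat U M \<and> null_object M (unit_obj M)"


section \<open>The functors \<open>\<tau>\<close>, \<open>\<kappa>\<close> and \<open>\<delta>\<close>\<close>

definition tau_obj :: "('o, 'a, 'y) moncat_scheme \<Rightarrow> 'o \<Rightarrow>
    ('o, 'a, 'p, 'b) cfunctor \<Rightarrow> ('o, 'a, 'p, 'b) cfunctor" where
  "tau_obj M x F = \<lparr>
    fob = (\<lambda>y\<in>Obj M. fob F (oplus M x y)),
    far = (\<lambda>f\<in>Arr M. far F (aplus M (Id M x) f))\<rparr>"

definition tau_arr :: "('o, 'a, 'y) moncat_scheme \<Rightarrow> 'o \<Rightarrow>
    ('o, 'a, 'p, 'b) ntrans \<Rightarrow> ('o, 'a, 'p, 'b) ntrans" where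
  "tau_arr M x \<eta> = \<lparr>
    ndom = tau_obj M x (ndom \<eta>),
    ncod = tau_obj M x (ncod \<eta>),
    ncomp = (\<lambda>y\<in>Obj M. ncomp \<eta> (oplus M x y))\<rparr>"

definition from_unit :: "('o, 'a, 'y) moncat_scheme \<Rightarrow> 'o \<Rightarrow> 'a" where
  "from_unit M x = (THE f. f \<in> Hom M (unit_obj M) x)"

text \<open>The map \<open>F = \<tau>\<^sub>0 F \<rightarrow> \<tau>\<^sub>x F\<close>, whose component at \<open>y\<close> is \<open>F y = F (0 \<oplus> y) \<rightarrow> F (x \<oplus> y)\<close>.\<close>

definition shift_map :: "('o, 'a, 'y) moncat_scheme \<Rightarrow> 'o \<Rightarrow>
    ('o, 'a, 'p, 'b) cfunctor \<Rightarrow> ('o, 'a, 'p, 'b) ntrans" where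
  "shift_map M x F = \<lparr>
    ndom = F,
    ncod = tau_obj M x F,
    ncomp = (\<lambda>y\<in>Obj M. far F (aplus M (from_unit M x) (Id M y)))\<rparr>"

text \<open>Kernels and cokernels in \<open>Fct M A\<close> are only determined up to isomorphism; one is chosen.\<close>

definition kappa_incl :: "('o, 'a, 'y) moncat_scheme \<Rightarrow> ('p, 'b, 'z) cat_scheme \<Rightarrow> 'o \<Rightarrow>
    ('o, 'a, 'p, 'b) cfunctor \<Rightarrow> ('o, 'a, 'p, 'b) ntrans" where
  "kappa_incl M A x F = (SOME k. is_kernel (Fct M A) (shift_map M x F) k)"

definition delta_proj :: "('o, 'a, 'y) moncat_scheme \<Rightarrow> ('p, 'b, 'z) cat_scheme \<Rightarrow> 'o \<Rightarrow>
    ('o, 'a, 'p, 'b) cfunctor \<Rightarrow> ('o, 'a, 'p, 'b) ntrans" where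
  "delta_proj M A x F = (SOME c. is_cokernel (Fct M A) (shift_map M x F) c)"

definition delta :: "('o, 'a, 'y) moncat_scheme \<Rightarrow> ('p, 'b, 'z) cat_scheme \<Rightarrow> 'o \<Rightarrow>
    (('o, 'a, 'p, 'b) cfunctor, ('o, 'a, 'p, 'b) ntrans,
     ('o, 'a, 'p, 'b) cfunctor, ('o, 'a, 'p, 'b) ntrans) cfunctor" where
  "delta M A x = \<lparr>
    fob = (\<lambda>F\<in>Obj (Fct M A). Cod (Fct M A) (delta_proj M A x F)),
    far = (\<lambda>\<eta>\<in>Arr (Fct M A). THE \<theta>.
      \<theta> \<in> Hom (Fct M A) (Cod (Fct M A) (delta_proj M A x (ndom \<eta>)))
                        (Cod (Fct M A) (delta_proj M A x (ncod \<eta>))) \<and>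
      \<theta> \<cdot>\<^bsub>Fct M A\<^esub> delta_proj M A x (ndom \<eta>) =
        delta_proj M A x (ncod \<eta>) \<cdot>\<^bsub>Fct M A\<^esub> tau_arr M x \<eta>)\<rparr>"


section \<open>Polynomial functors\<close>

text \<open>The subcategory \<open>{0}\<close> consists of all null objects, so that the classes below are closed under
  isomorphism.\<close>

inductive pol_strong :: "('o, 'a, 'y) moncat_scheme \<Rightarrow> ('p, 'b, 'z) cat_scheme \<Rightarrow> int \<Rightarrow>
    ('o, 'a, 'p, 'b) cfunctor \<Rightarrow> bool" for M A where
  "n < 0 \<Longrightarrow> null_object (Fct M A) F \<Longrightarrow> pol_strong M A n F"
| "n \<ge> 0 \<Longrightarrow> F \<in> Obj (Fct M A) \<Longrightarrow>
    (\<And>x. x \<in> Obj M \<Longrightarrow> pol_strong M A (n - 1) (fob (delta M A x) F)) \<Longrightarrow> pol_strong M A n F"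

definition strongly_polynomial :: "('o, 'a, 'y) moncat_scheme \<Rightarrow> ('p, 'b, 'z) cat_scheme \<Rightarrow>
    ('o, 'a, 'p, 'b) cfunctor \<Rightarrow> bool" where
  "strongly_polynomial M A F \<longleftrightarrow> (\<exists>n. pol_strong M A n F)"

definition strong_degree :: "('o, 'a, 'y) moncat_scheme \<Rightarrow> ('p, 'b, 'z) cat_scheme \<Rightarrow>
    ('o, 'a, 'p, 'b) cfunctor \<Rightarrow> enat" where
  "strong_degree M A F = Inf {enat k | k. pol_strong M A (int k) F}"

definition stably_null :: "('o, 'a, 'y) moncat_scheme \<Rightarrow> ('p, 'b, 'z) cat_scheme \<Rightarrow>
    ('o, 'a, 'p, 'b) cfunctor set" where
  "stably_null M A = {F \<in> Obj (Fct M A).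
    is_subobject_sum (Fct M A) F {kappa_incl M A x F | x. x \<in> Obj M} (Id (Fct M A) F)}"

abbreviation St :: "('o, 'a, 'y) moncat_scheme \<Rightarrow> ('p, 'b, 'z) cat_scheme \<Rightarrow>
    (('o, 'a, 'p, 'b) cfunctor,
     ('o, 'a, 'p, 'b) cfunctor \<times> ('o, 'a, 'p, 'b) cfunctor \<times>
       (('o, 'a, 'p, 'b) ntrans \<times> ('o, 'a, 'p, 'b) ntrans) set) cat" where
  "St M A \<equiv> quotient_cat (Fct M A) (stably_null M A)"

inductive pol_weak :: "('o, 'a, 'y) moncat_scheme \<Rightarrow> ('p, 'b, 'z) cat_scheme \<Rightarrow> int \<Rightarrow>
    ('o, 'a, 'p, 'b) cfunctor \<Rightarrow> bool" for M A where
  "n < 0 \<Longrightarrow> null_object (St M A) X \<Longrightarrow> pol_weak M A n X"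
| "n \<ge> 0 \<Longrightarrow> X \<in> Obj (St M A) \<Longrightarrow>
    (\<And>x. x \<in> Obj M \<Longrightarrow>
      pol_weak M A (n - 1) (fob (induced_functor (Fct M A) (stably_null M A) (delta M A x)) X)) \<Longrightarrow>
    pol_weak M A n X"

definition weakly_polynomial :: "('o, 'a, 'y) moncat_scheme \<Rightarrow> ('p, 'b, 'z) cat_scheme \<Rightarrow>
    ('o, 'a, 'p, 'b) cfunctor \<Rightarrow> bool" where
  "weakly_polynomial M A F \<longleftrightarrow>
    (\<exists>n. pol_weak M A n (fob (quotient_functor (Fct M A) (stably_null M A)) F))"

text \<open>The degree is \<open>-\<infinity>\<close> for null objects of \<open>St M A\<close>; the value \<open>\<infinity>\<close> means that the object is not
  polynomial. In contrast, the strong degree of a null functor is \<open>0\<close>.\<close>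

definition st_degree :: "('o, 'a, 'y) moncat_scheme \<Rightarrow> ('p, 'b, 'z) cat_scheme \<Rightarrow>
    ('o, 'a, 'p, 'b) cfunctor \<Rightarrow> ereal" where
  "st_degree M A X = Inf ({ereal (real k) | k. pol_weak M A (int k) X} \<union>
                          {d. d = -\<infinity> \<and> (\<exists>k<0. pol_weak M A k X)})"

definition weak_degree :: "('o, 'a, 'y) moncat_scheme \<Rightarrow> ('p, 'b, 'z) cat_scheme \<Rightarrow>
    ('o, 'a, 'p, 'b) cfunctor \<Rightarrow> ereal" where
  "weak_degree M A F = st_degree M A (fob (quotient_functor (Fct M A) (stably_null M A)) F)"

end

theory Submission
  imports Defs
begin

text \<open>When the unit of \<open>M\<close> is null, the composite \<open>0 \<rightarrow> x \<rightarrow> 0\<close> is the identity, so every map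
  \<open>F \<rightarrow> \<tau>\<^sub>x F\<close> is a split monomorphism and all the \<open>\<kappa>\<^sub>x F\<close> vanish. Hence the stably null functors
  are the null ones, the arrows inverted in the quotient \<open>St M A\<close> are already isomorphisms, and
  \<open>St M A\<close> has the same null objects as \<open>Fct M A\<close>. Since the induced endofunctors agree with
  \<open>\<delta>\<^sub>x\<close> on objects, the two inductive definitions of polynomial functors coincide.\<close>


section \<open>Zero arrows, monomorphisms and isomorphisms\<close>

text \<open>The step that needs work is the invertibility of an arrow \<open>s\<close> of
  \<open>Fct M A\<close> with null kernel and cokernel. These conditions are universal properties
  among functors, whereas invertibility is checked in \<open>A\<close>, object by object. The bridge
  is to assemble the kernels of all components of \<open>s\<close> into a functor \<open>K\<close>
  with a map to the source of \<open>s\<close>: this map is killed by \<open>s\<close>, hence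
  factors through the null kernel, hence vanishes at every object. Additivity of \<open>A\<close>
  then makes each component monic; the dual argument makes it epic, and an abelian category is
  balanced. Null objects of the quotient are found by looking at hom-sets: if the identity of
  \<open>X\<close> and its zero endomorphism have equal classes of roofs, a common refinement is
  both zero and invertible, which forces \<open>X\<close> to be null. The classes coincide in every
  index, but the degrees are read off differently: a null functor lies in the classes of negative
  index, which the weak degree records as minus infinity and the strong degree as 0. This is the
  origin of the exception in the second half of the theorem.\<close>

lemma Hom_iff: "f \<in> Hom C X Y \<longleftrightarrow> f \<in> Arr C \<and> Dom C f = X \<and> Cod C f = Y"
  by (auto simp: Hom_def)

definition iso_arrow :: "('o, 'a, 'z) cat_scheme \<Rightarrow> 'a \<Rightarrow> bool" where
  "iso_arrow C f \<longleftrightarrow> f \<in> Arr C \<and>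
    (\<exists>g\<in>Hom C (Cod C f) (Dom C f). g \<cdot>\<^bsub>C\<^esub> f = Id C (Dom C f) \<and> f \<cdot>\<^bsub>C\<^esub> g = Id C (Cod C f))"

section \<open>Null objects and zero arrows\<close>

lemma null_object_obj: "null_object C X \<Longrightarrow> X \<in> Obj C"
  by (simp add: null_object_def initial_object_def)

lemma null_object_from:
  assumes "null_object C Z" "X \<in> Obj C"
  obtains f where "f \<in> Hom C Z X"
  using assms unfolding null_object_def initial_object_def by blast

lemma null_object_to:
  assumes "null_object C Z" "X \<in> Obj C"
  obtains f where "f \<in> Hom C X Z"
  using assms unfolding null_object_def terminal_object_def by blast

context category
begin

lemma Hom_obj: "f \<in> Hom C X Y \<Longrightarrow> X \<in> Obj C \<and> Y \<in> Obj C"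
  using dom_obj cod_obj by (auto simp: Hom_iff)

lemma initial_unique:
  "initial_object C Z \<Longrightarrow> f \<in> Hom C Z X \<Longrightarrow> g \<in> Hom C Z X \<Longrightarrow> f = g"
  using Hom_obj unfolding initial_object_def by blast

lemma terminal_unique:
  "terminal_object C Z \<Longrightarrow> f \<in> Hom C X Z \<Longrightarrow> g \<in> Hom C X Z \<Longrightarrow> f = g"
  using Hom_obj unfolding terminal_object_def by blast

lemma zero_arrowI:
  assumes "null_object C Z" "g \<in> Hom C X Z" "h \<in> Hom C Z Y"
  shows "zero_arrow C (h \<cdot> g)"
proof -
  have "Dom C (h \<cdot> g) = X" "Cod C (h \<cdot> g) = Y" "h \<cdot> g \<in> Arr C"
    using comp_hom[OF assms(2,3)] by (simp_all add: Hom_iff)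
  then show ?thesis
    using assms unfolding zero_arrow_def by blast
qed

lemma zero_arrowE:
  assumes "zero_arrow C f" "f \<in> Hom C X Y"
  obtains Z g h where "null_object C Z" "g \<in> Hom C X Z" "h \<in> Hom C Z Y" "f = h \<cdot> g"
  using assms unfolding zero_arrow_def Hom_iff by blast

text \<open>Two zero arrows may factor through different null objects. An arrow \<open>j\<close>
  between these identifies the two factorizations, by initiality on one side and terminality on the
  other.\<close>

lemma zero_arrow_unique:
  assumes "zero_arrow C f" "zero_arrow C g" "f \<in> Hom C X Y" "g \<in> Hom C X Y"
  shows "f = g"
proof -
  obtain Z p i where f: "null_object C Z" "p \<in> Hom C X Z" "i \<in> Hom C Z Y" "f = i \<cdot> p"
    using assms by (elim zero_arrowE)
  obtain Z' p' i' where g: "null_object C Z'" "p' \<in> Hom C X Z'" "i' \<in> Hom C Z' Y" "g = i' \<cdot> p'"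
    using assms by (elim zero_arrowE)
  obtain j where j: "j \<in> Hom C Z Z'"
    using null_object_from[OF f(1)] null_object_obj[OF g(1)] by blast
  have "i = i' \<cdot> j"
    using f g comp_hom[OF j] initial_unique unfolding null_object_def by blast
  moreover have "j \<cdot> p = p'"
    using f g comp_hom[OF _ j] terminal_unique unfolding null_object_def by blast
  ultimately show ?thesis
    using f g j comp_assoc by metis
qed

lemma zero_arrow_comp_left:
  assumes "zero_arrow C f" "f \<in> Hom C X Y" "g \<in> Hom C Y W"
  shows "zero_arrow C (g \<cdot> f)"
proof -
  obtain Z p i where f: "null_object C Z" "p \<in> Hom C X Z" "i \<in> Hom C Z Y" "f = i \<cdot> p"
    using assms by (elim zero_arrowE)
  then have "g \<cdot> f = (g \<cdot> i) \<cdot> p"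
    using comp_assoc assms by metis
  then show ?thesis
    using zero_arrowI[OF f(1,2) comp_hom[OF f(3) assms(3)]] by simp
qed

lemma zero_arrow_comp_right:
  assumes "zero_arrow C g" "f \<in> Hom C X Y" "g \<in> Hom C Y W"
  shows "zero_arrow C (g \<cdot> f)"
proof -
  obtain Z p i where g: "null_object C Z" "p \<in> Hom C Y Z" "i \<in> Hom C Z W" "g = i \<cdot> p"
    using assms by (elim zero_arrowE)
  then have "g \<cdot> f = i \<cdot> (p \<cdot> f)"
    using comp_assoc assms by metis
  then show ?thesis
    using zero_arrowI[OF g(1) comp_hom[OF assms(2) g(2)] g(3)] by simp
qed

lemma zero_arrow_from_null: "null_object C X \<Longrightarrow> f \<in> Hom C X Y \<Longrightarrow> zero_arrow C f"
  using zero_arrowI id_hom comp_id null_object_obj by metis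

lemma zero_arrow_to_null: "null_object C Y \<Longrightarrow> f \<in> Hom C X Y \<Longrightarrow> zero_arrow C f"
  using zero_arrowI id_hom id_comp null_object_obj by metis

lemma zero_arrow_exists:
  assumes "null_object C Z" "X \<in> Obj C" "Y \<in> Obj C"
  obtains f where "f \<in> Hom C X Y" "zero_arrow C f"
  using assms zero_arrowI comp_hom null_object_from null_object_to by metis

text \<open>Every arrow into or out of \<open>X\<close> is its own composite with the identity,
  hence zero, and parallel zero arrows are equal. Retracts, kernels, cokernels and objects of the
  quotient are later recognised as null by this criterion.\<close>

lemma null_object_if_zero_Id:
  assumes "X \<in> Obj C" "zero_arrow C (Id C X)"
  shows "null_object C X"
proof -
  obtain Z p i where Z: "null_object C Z" "p \<in> Hom C X Z" "i \<in> Hom C Z X"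
    using assms id_hom by (elim zero_arrowE) auto
  have zero: "zero_arrow C f" if "f \<in> Hom C X Y \<or> f \<in> Hom C Y X" for f Y
    using that zero_arrow_comp_left[OF assms(2) id_hom[OF assms(1)]] comp_id[of f X Y]
      zero_arrow_comp_right[OF assms(2) _ id_hom[OF assms(1)]] id_comp[of f Y X] by fastforce
  have "(\<exists>!f. f \<in> Hom C X Y) \<and> (\<exists>!f. f \<in> Hom C Y X)" if Y: "Y \<in> Obj C" for Y
  proof -
    obtain f g where "f \<in> Hom C X Y" "g \<in> Hom C Y X"
      using zero_arrow_exists[OF Z(1) assms(1) Y] zero_arrow_exists[OF Z(1) Y assms(1)] by metis
    moreover have "u = v" if "u \<in> Hom C X Y" "v \<in> Hom C X Y" for u v
      using that zero zero_arrow_unique by blast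
    moreover have "u = v" if "u \<in> Hom C Y X" "v \<in> Hom C Y X" for u v
      using that zero zero_arrow_unique by blast
    ultimately show ?thesis
      by blast
  qed
  then show ?thesis
    using assms(1) unfolding null_object_def initial_object_def terminal_object_def by blast
qed

lemma null_object_retract:
  assumes "null_object C Z" "u \<in> Hom C X Z" "t \<in> Hom C Z X" "t \<cdot> u = Id C X"
  shows "null_object C X"
  using assms null_object_if_zero_Id zero_arrowI Hom_obj by metis

section \<open>Monomorphisms and epimorphisms\<close>

lemma monic_from_null:
  assumes "null_object C Z" "t \<in> Hom C Z X"
  shows "monic C t"
proof -
  have "t \<in> Arr C" "Dom C t = Z"
    using assms(2) by (simp_all add: Hom_iff)
  then show ?thesis
    using assms(1) terminal_unique unfolding monic_def null_object_def by blast
qed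

lemma monic_Id: "X \<in> Obj C \<Longrightarrow> monic C (Id C X)"
  using id_hom[of X] id_comp[where Y = X] unfolding monic_def by (simp add: Hom_iff)

lemma epic_Id: "X \<in> Obj C \<Longrightarrow> epic C (Id C X)"
  using id_hom[of X] comp_id[where X = X] unfolding epic_def by (simp add: Hom_iff)

lemma monic_zero_cancel:
  assumes f: "monic C f" and h: "h \<in> Hom C X (Dom C f)" "zero_arrow C (f \<cdot> h)"
  shows "zero_arrow C h"
proof -
  have fh: "f \<in> Hom C (Dom C f) (Cod C f)"
    using f by (simp add: monic_def Hom_iff)
  obtain Z where "null_object C Z"
    using h(2) unfolding zero_arrow_def by blast
  then obtain z where z: "z \<in> Hom C X (Dom C f)" "zero_arrow C z"
    using zero_arrow_exists Hom_obj[OF h(1)] by metis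
  then have "f \<cdot> h = f \<cdot> z"
    using zero_arrow_unique[OF h(2) zero_arrow_comp_left[OF _ z(1) fh]] comp_hom[OF _ fh] h(1) by blast
  then have "h = z"
    using f h(1) z(1) unfolding monic_def by blast
  then show ?thesis
    using z by simp
qed

lemma epic_zero_cancel:
  assumes f: "epic C f" and h: "h \<in> Hom C (Cod C f) X" "zero_arrow C (h \<cdot> f)"
  shows "zero_arrow C h"
proof -
  have fh: "f \<in> Hom C (Dom C f) (Cod C f)"
    using f by (simp add: epic_def Hom_iff)
  obtain Z where "null_object C Z"
    using h(2) unfolding zero_arrow_def by blast
  then obtain z where z: "z \<in> Hom C (Cod C f) X" "zero_arrow C z"
    using zero_arrow_exists Hom_obj[OF h(1)] by metis
  then have "h \<cdot> f = z \<cdot> f"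
    using zero_arrow_unique[OF h(2) zero_arrow_comp_right[OF _ fh z(1)]] comp_hom[OF fh] h(1) by blast
  then have "h = z"
    using f h(1) z(1) unfolding epic_def by blast
  then show ?thesis
    using z by simp
qed

section \<open>Kernels and cokernels\<close>

lemma kernel_hom:
  assumes "f \<in> Hom C X Y" "is_kernel C f k"
  shows "k \<in> Hom C (Dom C k) X" "zero_arrow C (f \<cdot> k)"
  using assms unfolding is_kernel_def Hom_iff by auto

lemma kernel_factor:
  assumes "is_kernel C f k" "f \<in> Hom C X Y" "h \<in> Hom C W X" "zero_arrow C (f \<cdot> h)"
  shows "\<exists>!u. u \<in> Hom C W (Dom C k) \<and> k \<cdot> u = h"
proof -
  have h: "h \<in> Arr C" "Cod C h = Dom C f" "Dom C h = W"
    using assms(2,3) by (simp_all add: Hom_iff)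
  have "\<exists>!u. u \<in> Hom C (Dom C h) (Dom C k) \<and> k \<cdot> u = h"
    using assms(1,4) h(1,2) unfolding is_kernel_def by simp
  then show ?thesis
    by (simp only: h(3))
qed

lemma cokernel_hom:
  assumes "f \<in> Hom C X Y" "is_cokernel C f c"
  shows "c \<in> Hom C Y (Cod C c)" "zero_arrow C (c \<cdot> f)"
  using assms unfolding is_cokernel_def Hom_iff by auto

lemma cokernel_factor:
  assumes "is_cokernel C f c" "f \<in> Hom C X Y" "h \<in> Hom C Y W" "zero_arrow C (h \<cdot> f)"
  shows "\<exists>!u. u \<in> Hom C (Cod C c) W \<and> u \<cdot> c = h"
proof -
  have h: "h \<in> Arr C" "Dom C h = Cod C f" "Cod C h = W"
    using assms(2,3) by (simp_all add: Hom_iff)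
  have "\<exists>!u. u \<in> Hom C (Cod C c) (Cod C h) \<and> u \<cdot> c = h"
    using assms(1,4) h(1,2) unfolding is_cokernel_def by simp
  then show ?thesis
    by (simp only: h(3))
qed

text \<open>An arrow \<open>h\<close> killed by \<open>f\<close> is itself zero and so factors
  through \<open>Z\<close>, uniquely because \<open>Z\<close> is terminal. Besides handling
  identities in \<open>Id_iso_mod\<close>, this gives the existence without which the choice in
  \<open>kappa_incl\<close> would be arbitrary.\<close>

lemma kernel_of_monic:
  assumes f: "monic C f" and Z: "null_object C Z" and k: "k \<in> Hom C Z (Dom C f)"
  shows "is_kernel C f k"
  unfolding is_kernel_def
proof (intro conjI ballI impI)
  have fh: "f \<in> Hom C (Dom C f) (Cod C f)"
    using f by (simp add: monic_def Hom_iff)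
  show "k \<in> Arr C" "Cod C k = Dom C f"
    using k by (auto simp: Hom_iff)
  show "zero_arrow C (f \<cdot> k)"
    using zero_arrow_from_null[OF Z comp_hom[OF k fh]] .
  fix h
  assume "h \<in> Arr C" "Cod C h = Dom C f \<and> zero_arrow C (f \<cdot> h)"
  then have h: "h \<in> Hom C (Dom C h) (Dom C f)" "zero_arrow C h"
    using monic_zero_cancel[OF f, of h] by (auto simp: Hom_iff)
  obtain u where u: "u \<in> Hom C (Dom C h) Z"
    using null_object_to[OF Z] Hom_obj[OF h(1)] by blast
  have "k \<cdot> u = h"
    using zero_arrow_unique[OF zero_arrowI[OF Z u k] h(2) comp_hom[OF u k] h(1)] .
  moreover have "Dom C k = Z"
    using k by (simp add: Hom_iff)
  ultimately show "\<exists>!u. u \<in> Hom C (Dom C h) (Dom C k) \<and> k \<cdot> u = h"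
    using u terminal_unique Z unfolding null_object_def by blast
qed

lemma cokernel_of_epic:
  assumes f: "epic C f" and Z: "null_object C Z" and c: "c \<in> Hom C (Cod C f) Z"
  shows "is_cokernel C f c"
  unfolding is_cokernel_def
proof (intro conjI ballI impI)
  have fh: "f \<in> Hom C (Dom C f) (Cod C f)"
    using f by (simp add: epic_def Hom_iff)
  show "c \<in> Arr C" "Dom C c = Cod C f"
    using c by (auto simp: Hom_iff)
  show "zero_arrow C (c \<cdot> f)"
    using zero_arrow_to_null[OF Z comp_hom[OF fh c]] .
  fix h
  assume "h \<in> Arr C" "Dom C h = Cod C f \<and> zero_arrow C (h \<cdot> f)"
  then have h: "h \<in> Hom C (Cod C f) (Cod C h)" "zero_arrow C h"
    using epic_zero_cancel[OF f, of h] by (auto simp: Hom_iff)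
  obtain u where u: "u \<in> Hom C Z (Cod C h)"
    using null_object_from[OF Z] Hom_obj[OF h(1)] by blast
  have "u \<cdot> c = h"
    using zero_arrow_unique[OF zero_arrowI[OF Z c u] h(2) comp_hom[OF c u] h(1)] .
  moreover have "Cod C c = Z"
    using c by (simp add: Hom_iff)
  ultimately show "\<exists>!u. u \<in> Hom C (Cod C c) (Cod C h) \<and> u \<cdot> c = h"
    using u initial_unique Z unfolding null_object_def by blast
qed

text \<open>The kernel arrow \<open>k\<close> is zero, so it factors through itself both by the
  identity and by a zero endomorphism \<open>z\<close>; uniqueness of the factorization equates the
  two.\<close>

lemma kernel_of_monic_null:
  assumes "monic C f" "is_kernel C f k"
  shows "null_object C (Dom C k)"
proof -
  have f: "f \<in> Hom C (Dom C f) (Cod C f)"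
    using assms(1) by (simp add: monic_def Hom_iff)
  note k = kernel_hom[OF f assms(2)]
  have zk: "zero_arrow C k"
    using monic_zero_cancel[OF assms(1) k] .
  obtain Z where "null_object C Z"
    using k(2) unfolding zero_arrow_def by blast
  then obtain z where z: "z \<in> Hom C (Dom C k) (Dom C k)" "zero_arrow C z"
    using zero_arrow_exists Hom_obj[OF k(1)] by metis
  have Id: "Id C (Dom C k) \<in> Hom C (Dom C k) (Dom C k)" "k \<cdot> Id C (Dom C k) = k"
    using id_hom comp_id[OF k(1)] Hom_obj[OF k(1)] by auto
  have "k \<cdot> z = k"
    using zero_arrow_unique[OF zero_arrow_comp_left[OF z(2,1) k(1)] zk comp_hom[OF z(1) k(1)] k(1)] .
  then have "Id C (Dom C k) = z"
    using kernel_factor[OF assms(2) f k(1,2)] z(1) Id by blast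
  then show ?thesis
    using null_object_if_zero_Id Hom_obj[OF k(1)] z(2) by simp
qed

text \<open>Every arrow into a null object is epic, with the identity as a cokernel. For an
  arbitrary cokernel \<open>c\<close>, initiality of \<open>Y\<close> gives
  \<open>z \<cdot> c = c\<close> with \<open>z\<close> zero, so \<open>z\<close> is the identity.
  Both halves serve \<open>delta_null\<close>.\<close>

lemma cokernel_to_null:
  assumes "null_object C Y" "f \<in> Hom C X Y"
  shows "\<exists>c. is_cokernel C f c"
    and "is_cokernel C f c \<Longrightarrow> null_object C (Cod C c)"
proof -
  have Y: "Y \<in> Obj C"
    using assms(1) by (rule null_object_obj)
  have [simp]: "f \<in> Arr C" "Cod C f = Y"
    using assms(2) by (auto simp: Hom_iff)
  have "epic C f"
    using assms(1) initial_unique unfolding epic_def null_object_def by auto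
  then have "is_cokernel C f (Id C Y)"
    using cokernel_of_epic[of f Y] assms id_hom[OF Y] by (simp add: Hom_iff)
  then show "\<exists>c. is_cokernel C f c" ..
  assume c: "is_cokernel C f c"
  note c' = cokernel_hom[OF assms(2) c]
  obtain z where z: "z \<in> Hom C (Cod C c) (Cod C c)" "zero_arrow C z"
    using zero_arrow_exists[OF assms(1)] Hom_obj[OF c'(1)] by metis
  have "z \<cdot> c = c"
    using initial_unique[of Y] assms(1) comp_hom[OF c'(1) z(1)] c'(1) unfolding null_object_def by blast
  then have "Id C (Cod C c) = z"
    using cokernel_factor[OF c assms(2) c'] z(1) id_hom id_comp[OF c'(1)] Hom_obj[OF c'(1)] by blast
  then show "null_object C (Cod C c)"
    using null_object_if_zero_Id Hom_obj[OF c'(1)] z(2) by simp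
qed

end


section \<open>Quotient by the null objects\<close>

context category
begin

text \<open>Roofs whose first leg is the identity, the images of the arrows of \<open>C\<close>, are
  legitimate because an identity has null kernel and cokernel.\<close>

lemma Id_iso_mod:
  assumes "null_object C Z" "X \<in> Obj C"
  shows "Id C X \<in> iso_mod C {X. null_object C X}"
proof -
  obtain k where k: "k \<in> Hom C Z X"
    using null_object_from assms by metis
  obtain c where c: "c \<in> Hom C X Z"
    using null_object_to assms by metis
  have "Id C X \<in> Hom C X X"
    using id_hom assms by simp
  then have "is_kernel C (Id C X) k" "is_cokernel C (Id C X) c" "Id C X \<in> Arr C"
    using kernel_of_monic[OF monic_Id assms(1)] cokernel_of_epic[OF epic_Id assms(1)] assms(2) k c
    by (auto simp: Hom_iff)
  moreover have "Dom C k = Z" "Cod C c = Z"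
    using k c by (auto simp: Hom_iff)
  ultimately show ?thesis
    using assms(1) unfolding iso_mod_def mem_Collect_eq by metis
qed

lemma Hom_quotient_cat:
  assumes "X \<in> Obj C" "Y \<in> Obj C"
  shows "Hom (quotient_cat C S) X Y = {(X, Y, R) | R. R \<in> roofs C S X Y // roof_equiv C S X Y}"
  using assms unfolding Hom_def quotient_cat_def by auto

text \<open>Being null is a condition on hom-sets, so the question is when all roofs between two
  objects are equivalent. Since first legs are isomorphisms of \<open>C\<close>, this happens as
  soon as one end is null in \<open>C\<close>; conversely, it makes the identity of \<open>X\<close>
  equivalent to a zero arrow.\<close>

lemma null_object_quotient_cat:
  assumes Z: "null_object C Z"
    and iso: "\<And>s. s \<in> iso_mod C {X. null_object C X} \<Longrightarrow> iso_arrow C s"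
  shows "null_object (quotient_cat C {X. null_object C X}) X \<longleftrightarrow> null_object C X"
proof
  let ?S = "{X. null_object C X}"
  let ?Q = "quotient_cat C ?S"
  assume Q: "null_object ?Q X"
  then have X: "X \<in> Obj C"
    using null_object_obj[OF Q] by (simp add: quotient_cat_def)
  obtain z where z: "z \<in> Hom C X X" "zero_arrow C z"
    using zero_arrow_exists[OF Z X X] .
  let ?i = "Id C X"
  let ?E = "roof_equiv C ?S X X"
  have i: "?i \<in> Hom C X X" "?i \<in> iso_mod C ?S"
    using id_hom Id_iso_mod Z X by auto
  have roofs: "(?i, ?i) \<in> roofs C ?S X X" "(?i, z) \<in> roofs C ?S X X"
    using i z unfolding roofs_def Hom_iff by auto
  have "(X, X, ?E `` {(?i, ?i)}) \<in> Hom ?Q X X" "(X, X, ?E `` {(?i, z)}) \<in> Hom ?Q X X"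
    using roofs unfolding Hom_quotient_cat[OF X X] quotient_def by auto
  moreover have "\<exists>!f. f \<in> Hom ?Q X X"
    using Q unfolding null_object_def initial_object_def by blast
  ultimately have "?E `` {(?i, ?i)} = ?E `` {(?i, z)}"
    by blast
  moreover have "((?i, ?i), (?i, ?i)) \<in> ?E"
    using roofs(1) i comp_id[OF i(1)] unfolding roof_equiv_def
    by (auto simp: Hom_iff intro!: exI[of _ ?i])
  ultimately have "((?i, z), (?i, ?i)) \<in> ?E"
    by blast
  \<comment> \<open>Both first legs are the identity, so the refinement has \<open>u = v\<close>,
    and comparing second legs gives \<open>z \<cdot> u = u\<close>. Hence \<open>u\<close> is zero,
    while membership in \<open>iso_mod\<close> makes it invertible.\<close>
  then obtain W u v where uv: "u \<in> Hom C W X" "v \<in> Hom C W X" "?i \<cdot> u = ?i \<cdot> v"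
      "?i \<cdot> u \<in> iso_mod C ?S" "z \<cdot> u = ?i \<cdot> v"
    using i(1) unfolding roof_equiv_def Hom_iff by auto
  then have u: "u \<in> iso_mod C ?S" "z \<cdot> u = u"
    using id_comp by metis+
  then have "zero_arrow C u"
    using zero_arrow_comp_right[OF z(2) uv(1) z(1)] by simp
  moreover have "Dom C u = W" "Cod C u = X"
    using uv(1) by (simp_all add: Hom_iff)
  then obtain g where g: "g \<in> Hom C X W" "u \<cdot> g = ?i"
    using iso[OF u(1)] unfolding iso_arrow_def by metis
  ultimately show "null_object C X"
    using null_object_if_zero_Id[OF X] zero_arrow_comp_right[OF _ g(1) uv(1)] by simp
next
  let ?S = "{X. null_object C X}"
  let ?Q = "quotient_cat C ?S"
  assume X: "null_object C X"
  have XO: "X \<in> Obj C"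
    using null_object_obj[OF X] .
  have unique: "\<exists>!f. f \<in> Hom ?Q V W"
    if VW: "V \<in> Obj C" "W \<in> Obj C" "V = X \<or> W = X" for V W
  proof -
    let ?E = "roof_equiv C ?S V W"
    have "((s, f), (t, g)) \<in> ?E"
      if sf: "(s, f) \<in> roofs C ?S V W" and tg: "(t, g) \<in> roofs C ?S V W" for s f t g
    proof -
      \<comment> \<open>Inverses of the first legs refine both roofs to roofs on \<open>V\<close>
        whose first leg is the identity. What remains is to compare two arrows from \<open>V\<close>
        to \<open>W\<close>, and one of these objects is null.\<close>
      obtain u where u: "u \<in> Hom C V (Dom C s)" "s \<cdot> u = Id C V"
        using sf iso[of s] unfolding roofs_def iso_arrow_def by auto
      obtain v where v: "v \<in> Hom C V (Dom C t)" "t \<cdot> v = Id C V"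
        using tg iso[of t] unfolding roofs_def iso_arrow_def by auto
      have "f \<in> Hom C (Dom C s) W" "g \<in> Hom C (Dom C t) W"
        using sf tg unfolding roofs_def Hom_iff by auto
      then have "f \<cdot> u \<in> Hom C V W" "g \<cdot> v \<in> Hom C V W"
        using comp_hom u v by blast+
      then have "f \<cdot> u = g \<cdot> v"
        using X VW(3) initial_unique terminal_unique unfolding null_object_def by blast
      moreover have "s \<cdot> u = t \<cdot> v" "s \<cdot> u \<in> iso_mod C ?S"
        using u(2) v(2) Id_iso_mod[OF Z VW(1)] by simp_all
      ultimately show ?thesis
        using sf tg u(1) v(1) unfolding roof_equiv_def by blast
    qed
    then have E: "?E `` {r} = roofs C ?S V W" if "r \<in> roofs C ?S V W" for r
      using that unfolding roof_equiv_def by (cases r) blast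
    obtain z where "z \<in> Hom C V W"
      using zero_arrow_exists[OF Z VW(1,2)] by blast
    then have "(Id C V, z) \<in> roofs C ?S V W"
      using Id_iso_mod[OF Z VW(1)] id_hom[OF VW(1)] unfolding roofs_def Hom_iff by auto
    then have "roofs C ?S V W // ?E = {roofs C ?S V W}"
      using E unfolding quotient_def by blast
    then show ?thesis
      unfolding Hom_quotient_cat[OF VW(1,2)] by auto
  qed
  have "Obj ?Q = Obj C"
    by (simp add: quotient_cat_def)
  then show "null_object ?Q X"
    using XO unique unfolding null_object_def initial_object_def terminal_object_def by auto
qed

end


section \<open>Abelian categories\<close>

context category
begin

text \<open>\<open>w\<close> is the difference of \<open>u\<close> and \<open>v\<close>. Its
  properties are expressed through zero arrows alone, so that the group structure on the hom-sets
  stays inside this proof.\<close>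

lemma preadditive_difference:
  assumes "preadditive C" and Z: "null_object C Z" and u: "u \<in> Hom C X Y" and v: "v \<in> Hom C X Y"
  obtains w where "w \<in> Hom C X Y" "zero_arrow C w \<Longrightarrow> u = v"
    "\<And>f W. f \<in> Hom C Y W \<Longrightarrow> f \<cdot> u = f \<cdot> v \<Longrightarrow> zero_arrow C (f \<cdot> w)"
    "\<And>f W. f \<in> Hom C W X \<Longrightarrow> u \<cdot> f = v \<cdot> f \<Longrightarrow> zero_arrow C (w \<cdot> f)"
proof -
  obtain add zero where
    group: "\<forall>X\<in>Obj C. \<forall>Y\<in>Obj C. comm_group \<lparr>carrier = Hom C X Y, mult = add, one = zero X Y\<rparr>"
    and dist: "\<forall>X\<in>Obj C. \<forall>Y\<in>Obj C. \<forall>Z\<in>Obj C.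
      \<forall>f\<in>Hom C X Y. \<forall>f'\<in>Hom C X Y. \<forall>g\<in>Hom C Y Z. \<forall>g'\<in>Hom C Y Z.
        g \<cdot> add f f' = add (g \<cdot> f) (g \<cdot> f') \<and> add g g' \<cdot> f = add (g \<cdot> f) (g' \<cdot> f)"
    using assms(1) unfolding preadditive_def by (elim exE conjE)
  have left: "g \<cdot> add f f' = add (g \<cdot> f) (g \<cdot> f')"
    if "f \<in> Hom C X Y" "f' \<in> Hom C X Y" "g \<in> Hom C Y Z" for X Y Z f f' g
    using dist that Hom_obj[OF that(1)] Hom_obj[OF that(3)] by blast
  have right: "add g g' \<cdot> f = add (g \<cdot> f) (g' \<cdot> f)"
    if "f \<in> Hom C X Y" "g \<in> Hom C Y Z" "g' \<in> Hom C Y Z" for X Y Z f g g'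
    using dist that Hom_obj[OF that(1)] Hom_obj[OF that(2)] by blast
  have XY: "X \<in> Obj C" "Y \<in> Obj C"
    using Hom_obj[OF u] by auto
  let ?G = "\<lparr>carrier = Hom C X Y, mult = add, one = zero X Y\<rparr>"
  interpret G: comm_group ?G
    using group XY by blast
  obtain p where p: "p \<in> Hom C X Z"
    using null_object_to[OF Z XY(1)] .
  obtain i where i: "i \<in> Hom C Z Y"
    using null_object_from[OF Z XY(2)] .
  interpret H: comm_group "\<lparr>carrier = Hom C X Z, mult = add, one = zero X Z\<rparr>"
    using group XY(1) null_object_obj[OF Z] by blast
  have ip: "i \<cdot> p \<in> Hom C X Y" "zero_arrow C (i \<cdot> p)"
    using comp_hom[OF p i] zero_arrowI[OF Z p i] by auto
  \<comment> \<open>The neutral element of the hom-group has to be identified with the zero arrow.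
    As \<open>Z\<close> is terminal, \<open>p\<close> is idempotent for \<open>add\<close>; so is
    \<open>i \<cdot> p\<close> by distributivity, and an idempotent of a group is neutral.\<close>
  have "add p p = p"
    using H.m_closed[of p p] p terminal_unique Z unfolding null_object_def by auto
  then have "add (i \<cdot> p) (i \<cdot> p) = i \<cdot> p"
    using left[OF p p i] by simp
  then have zero: "i \<cdot> p = zero X Y"
    using G.l_cancel_one[of "i \<cdot> p" "i \<cdot> p"] ip by simp
  let ?v = "inv\<^bsub>?G\<^esub> v"
  have v': "?v \<in> Hom C X Y"
    using G.inv_closed[of v] v by simp
  have vv: "add v ?v = zero X Y"
    using G.r_inv[of v] v by simp
  show ?thesis
  proof
    show w: "add u ?v \<in> Hom C X Y"
      using G.m_closed[of u ?v] u v' by simp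
    show "u = v" if "zero_arrow C (add u ?v)"
    proof -
      have "add u ?v = add v ?v"
        using zero_arrow_unique[OF that ip(2) w ip(1)] zero vv by simp
      then show ?thesis
        using G.right_cancel[of ?v u v] u v v' by simp
    qed
    show "zero_arrow C (f \<cdot> add u ?v)" if "f \<in> Hom C Y W" "f \<cdot> u = f \<cdot> v" for f W
    proof -
      \<comment> \<open>By distributivity \<open>f\<close> has the same composite with
        \<open>add u ?v\<close> as with \<open>add v ?v\<close>, which is the zero arrow
        \<open>i \<cdot> p\<close>. This avoids relating composition to inverses.\<close>
      have "f \<cdot> add u ?v = f \<cdot> (i \<cdot> p)"
        using left[OF u v' that(1)] left[OF v v' that(1)] that(2) vv zero by simp
      then show ?thesis
        using zero_arrow_comp_left[OF ip(2,1) that(1)] by simp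
    qed
    show "zero_arrow C (add u ?v \<cdot> f)" if "f \<in> Hom C W X" "u \<cdot> f = v \<cdot> f" for f W
    proof -
      have "add u ?v \<cdot> f = (i \<cdot> p) \<cdot> f"
        using right[OF that(1) u v'] right[OF that(1) v v'] that(2) vv zero by simp
      then show ?thesis
        using zero_arrow_comp_right[OF ip(2) that(1) ip(1)] by simp
    qed
  qed
qed

text \<open>If \<open>u\<close> and \<open>v\<close> agree after \<open>f\<close>, their difference
  is killed by \<open>f\<close>, so it factors through the zero arrow \<open>k\<close> and
  vanishes.\<close>

lemma monic_if_kernel_zero:
  assumes "preadditive C" "f \<in> Hom C X Y" "is_kernel C f k" "zero_arrow C k"
  shows "monic C f"
proof -
  obtain Z where Z: "null_object C Z"
    using assms(4) unfolding zero_arrow_def by blast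
  note k = kernel_hom[OF assms(2,3)]
  have "u = v" if uv: "u \<in> Hom C W X" "v \<in> Hom C W X" "f \<cdot> u = f \<cdot> v" for W u v
  proof -
    obtain w where w: "w \<in> Hom C W X" "zero_arrow C w \<Longrightarrow> u = v" "zero_arrow C (f \<cdot> w)"
      using preadditive_difference[OF assms(1) Z uv(1,2)] assms(2) uv(3) by metis
    obtain t where "t \<in> Hom C W (Dom C k)" "k \<cdot> t = w"
      using kernel_factor[OF assms(3,2) w(1,3)] by blast
    then show ?thesis
      using w(2) zero_arrow_comp_right[OF assms(4) _ k(1)] by blast
  qed
  moreover have "f \<in> Arr C" "Dom C f = X"
    using assms(2) by (simp_all add: Hom_iff)
  ultimately show ?thesis
    unfolding monic_def by blast
qed

lemma epic_if_cokernel_zero: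
  assumes "preadditive C" "f \<in> Hom C X Y" "is_cokernel C f c" "zero_arrow C c"
  shows "epic C f"
proof -
  obtain Z where Z: "null_object C Z"
    using assms(4) unfolding zero_arrow_def by blast
  note c = cokernel_hom[OF assms(2,3)]
  have "u = v" if uv: "u \<in> Hom C Y W" "v \<in> Hom C Y W" "u \<cdot> f = v \<cdot> f" for W u v
  proof -
    obtain w where w: "w \<in> Hom C Y W" "zero_arrow C w \<Longrightarrow> u = v" "zero_arrow C (w \<cdot> f)"
      using preadditive_difference[OF assms(1) Z uv(1,2)] assms(2) uv(3) by metis
    obtain t where "t \<in> Hom C (Cod C c) W" "t \<cdot> c = w"
      using cokernel_factor[OF assms(3,2) w(1,3)] by blast
    then show ?thesis
      using w(2) zero_arrow_comp_left[OF assms(4) c(1)] by blast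
  qed
  moreover have "f \<in> Arr C" "Cod C f = Y"
    using assms(2) by (simp_all add: Hom_iff)
  ultimately show ?thesis
    unfolding epic_def by blast
qed

text \<open>A monic \<open>f\<close> is the kernel of some \<open>g\<close>. Since \<open>f\<close>
  is epic, \<open>g\<close> is zero, so the identity of \<open>Y\<close> factors through
  \<open>f\<close>; this right inverse is two-sided because \<open>f\<close> is monic.\<close>

lemma abelian_balanced:
  assumes "abelian_category C" "monic C f" "epic C f" "f \<in> Hom C X Y"
  obtains h where "h \<in> Hom C Y X" "h \<cdot> f = Id C X" "f \<cdot> h = Id C Y"
proof -
  have XY: "X \<in> Obj C" "Y \<in> Obj C" "Dom C f = X" "Cod C f = Y"
    using Hom_obj[OF assms(4)] assms(4) by (auto simp: Hom_iff)
  obtain g where "g \<in> Arr C" "is_kernel C g f"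
    using assms(1,2) unfolding abelian_category_def by blast
  moreover then have g: "g \<in> Hom C Y (Cod C g)"
    using XY by (simp add: is_kernel_def Hom_iff)
  ultimately have "zero_arrow C (g \<cdot> f)"
    using kernel_hom by blast
  then have "zero_arrow C (g \<cdot> Id C Y)"
    using epic_zero_cancel[OF assms(3), of g] g XY comp_id[OF g] by simp
  then obtain h where h: "h \<in> Hom C Y X" "f \<cdot> h = Id C Y"
    using kernel_factor[OF \<open>is_kernel C g f\<close> g id_hom[OF XY(2)]] XY by auto
  have "f \<cdot> (h \<cdot> f) = f \<cdot> Id C X"
    using comp_assoc[OF assms(4) h(1) assms(4)] h(2) id_comp[OF assms(4)] comp_id[OF assms(4)]
    by simp
  then have "h \<cdot> f = Id C X"
    using assms(2) comp_hom[OF assms(4) h(1)] id_hom[OF XY(1)] XY unfolding monic_def by auto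
  then show ?thesis
    using that h by blast
qed

end


section \<open>Functor categories\<close>

lemma Fct_simps [simp]:
  "Obj (Fct M A) = functors M A"
  "Arr (Fct M A) = ntranss M A"
  "Dom (Fct M A) = ndom"
  "Cod (Fct M A) = ncod"
  "ndom (Id (Fct M A) F) = F"
  "ncod (Id (Fct M A) F) = F"
  "ndom (\<theta> \<cdot>\<^bsub>Fct M A\<^esub> \<eta>) = ndom \<eta>"
  "ncod (\<theta> \<cdot>\<^bsub>Fct M A\<^esub> \<eta>) = ncod \<theta>"
  "x \<in> Obj M \<Longrightarrow> ncomp (Id (Fct M A) F) x = Id A (fob F x)"
  "x \<in> Obj M \<Longrightarrow> ncomp (\<theta> \<cdot>\<^bsub>Fct M A\<^esub> \<eta>) x = ncomp \<theta> x \<cdot>\<^bsub>A\<^esub> ncomp \<eta> x"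
  by (simp_all add: Fct_def)

lemma Fct_ncomp_extensional:
  "ncomp (Id (Fct M A) F) \<in> extensional (Obj M)"
  "ncomp (\<theta> \<cdot>\<^bsub>Fct M A\<^esub> \<eta>) \<in> extensional (Obj M)"
  by (simp_all add: Fct_def)

lemma Hom_Fct_iff: "\<eta> \<in> Hom (Fct M A) F G \<longleftrightarrow> \<eta> \<in> ntranss M A \<and> ndom \<eta> = F \<and> ncod \<eta> = G"
  by (simp add: Hom_iff)

locale functor_category = M: category M + A: category A
  for M :: "('o, 'a, 'y) cat_scheme" and A :: "('p, 'b, 'z) cat_scheme"
begin

lemma fob_obj: "F \<in> functors M A \<Longrightarrow> x \<in> Obj M \<Longrightarrow> fob F x \<in> Obj A"
  by (simp add: functors_def)

lemma far_hom: "F \<in> functors M A \<Longrightarrow> f \<in> Hom M x y \<Longrightarrow> far F f \<in> Hom A (fob F x) (fob F y)"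
  using M.Hom_obj[of f x y] by (simp add: functors_def)

lemma far_id: "F \<in> functors M A \<Longrightarrow> x \<in> Obj M \<Longrightarrow> far F (Id M x) = Id A (fob F x)"
  by (simp add: functors_def)

lemma far_comp:
  assumes "F \<in> functors M A" "f \<in> Hom M x y" "g \<in> Hom M y z"
  shows "far F (g \<cdot>\<^bsub>M\<^esub> f) = far F g \<cdot>\<^bsub>A\<^esub> far F f"
  using assms M.Hom_obj[OF assms(2)] M.Hom_obj[OF assms(3)] unfolding functors_def by blast

lemma functorsI:
  assumes "fob F \<in> extensional (Obj M)" "far F \<in> extensional (Arr M)"
    and "\<And>x. x \<in> Obj M \<Longrightarrow> fob F x \<in> Obj A"
    and "\<And>x y f. f \<in> Hom M x y \<Longrightarrow> far F f \<in> Hom A (fob F x) (fob F y)"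
    and "\<And>x. x \<in> Obj M \<Longrightarrow> far F (Id M x) = Id A (fob F x)"
    and "\<And>x y z f g. f \<in> Hom M x y \<Longrightarrow> g \<in> Hom M y z \<Longrightarrow>
      far F (g \<cdot>\<^bsub>M\<^esub> f) = far F g \<cdot>\<^bsub>A\<^esub> far F f"
  shows "F \<in> functors M A"
  using assms unfolding functors_def by blast

lemma Hom_Fct_functors:
  "\<eta> \<in> Hom (Fct M A) F G \<Longrightarrow> F \<in> functors M A \<and> G \<in> functors M A"
  unfolding Hom_Fct_iff ntranss_def by auto

lemma ncomp_hom:
  "\<eta> \<in> Hom (Fct M A) F G \<Longrightarrow> x \<in> Obj M \<Longrightarrow> ncomp \<eta> x \<in> Hom A (fob F x) (fob G x)"
  unfolding Hom_Fct_iff ntranss_def by auto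

lemma ncomp_natural:
  assumes "\<eta> \<in> Hom (Fct M A) F G" "f \<in> Hom M x y"
  shows "ncomp \<eta> y \<cdot>\<^bsub>A\<^esub> far F f = far G f \<cdot>\<^bsub>A\<^esub> ncomp \<eta> x"
  using assms M.Hom_obj[OF assms(2)] unfolding Hom_Fct_iff ntranss_def by blast

lemma Hom_FctI:
  assumes "F \<in> functors M A" "G \<in> functors M A" "ndom \<eta> = F" "ncod \<eta> = G"
    and "ncomp \<eta> \<in> extensional (Obj M)"
    and "\<And>x. x \<in> Obj M \<Longrightarrow> ncomp \<eta> x \<in> Hom A (fob F x) (fob G x)"
    and "\<And>x y f. f \<in> Hom M x y \<Longrightarrow> ncomp \<eta> y \<cdot>\<^bsub>A\<^esub> far F f = far G f \<cdot>\<^bsub>A\<^esub> ncomp \<eta> x"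
  shows "\<eta> \<in> Hom (Fct M A) F G"
  using assms unfolding Hom_Fct_iff ntranss_def by simp

lemma ntrans_exists:
  assumes "F \<in> functors M A" "G \<in> functors M A"
    and "\<And>x. x \<in> Obj M \<Longrightarrow> t x \<in> Hom A (fob F x) (fob G x)"
    and "\<And>x y f. f \<in> Hom M x y \<Longrightarrow> t y \<cdot>\<^bsub>A\<^esub> far F f = far G f \<cdot>\<^bsub>A\<^esub> t x"
  obtains \<eta> where "\<eta> \<in> Hom (Fct M A) F G" "\<And>x. x \<in> Obj M \<Longrightarrow> ncomp \<eta> x = t x"
proof
  let ?\<eta> = "\<lparr>ndom = F, ncod = G, ncomp = (\<lambda>x\<in>Obj M. t x)\<rparr>"
  show "?\<eta> \<in> Hom (Fct M A) F G"
  proof (rule Hom_FctI)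
    fix x y f
    assume "f \<in> Hom M x y"
    then show "ncomp ?\<eta> y \<cdot>\<^bsub>A\<^esub> far F f = far G f \<cdot>\<^bsub>A\<^esub> ncomp ?\<eta> x"
      using assms(4) M.Hom_obj by fastforce
  qed (use assms(1-3) in auto)
  show "ncomp ?\<eta> x = t x" if "x \<in> Obj M" for x
    using that by simp
qed

lemma ntrans_eqI:
  assumes "\<eta> \<in> Hom (Fct M A) F G" "\<theta> \<in> Hom (Fct M A) F G"
    and "\<And>x. x \<in> Obj M \<Longrightarrow> ncomp \<eta> x = ncomp \<theta> x"
  shows "\<eta> = \<theta>"
proof -
  have "ncomp \<eta> = ncomp \<theta>"
    using assms by (intro extensionalityI[of _ "Obj M"]) (auto simp: Hom_Fct_iff ntranss_def)
  then show ?thesis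
    using assms(1,2) by (simp add: Hom_Fct_iff)
qed

lemma Fct_id_hom:
  assumes "F \<in> functors M A"
  shows "Id (Fct M A) F \<in> Hom (Fct M A) F F"
proof (rule Hom_FctI[OF assms assms])
  fix x y f
  assume f: "f \<in> Hom M x y"
  show "ncomp (Id (Fct M A) F) y \<cdot>\<^bsub>A\<^esub> far F f = far F f \<cdot>\<^bsub>A\<^esub> ncomp (Id (Fct M A) F) x"
    using M.Hom_obj[OF f] A.id_comp[OF far_hom[OF assms f]] A.comp_id[OF far_hom[OF assms f]]
    by simp
qed (use Fct_ncomp_extensional(1) A.id_hom fob_obj[OF assms] in simp_all)

lemma Fct_comp_hom:
  assumes \<eta>: "\<eta> \<in> Hom (Fct M A) F G" and \<theta>: "\<theta> \<in> Hom (Fct M A) G H"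
  shows "\<theta> \<cdot>\<^bsub>Fct M A\<^esub> \<eta> \<in> Hom (Fct M A) F H"
proof (rule Hom_FctI)
  show F: "F \<in> functors M A" and H: "H \<in> functors M A"
    using assms Hom_Fct_functors by blast+
  have G: "G \<in> functors M A"
    using assms Hom_Fct_functors by blast
  show "ncomp (\<theta> \<cdot>\<^bsub>Fct M A\<^esub> \<eta>) x \<in> Hom A (fob F x) (fob H x)" if "x \<in> Obj M" for x
    using that A.comp_hom[OF ncomp_hom[OF \<eta> that] ncomp_hom[OF \<theta> that]] by simp
  fix x y f
  assume f: "f \<in> Hom M x y"
  then have xy: "x \<in> Obj M" "y \<in> Obj M"
    using M.Hom_obj by auto
  have "(ncomp \<theta> y \<cdot>\<^bsub>A\<^esub> ncomp \<eta> y) \<cdot>\<^bsub>A\<^esub> far F f = ncomp \<theta> y \<cdot>\<^bsub>A\<^esub> (ncomp \<eta> y \<cdot>\<^bsub>A\<^esub> far F f)"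
    using A.comp_assoc[OF far_hom[OF F f] ncomp_hom[OF \<eta> xy(2)] ncomp_hom[OF \<theta> xy(2)]] .
  also have "\<dots> = (ncomp \<theta> y \<cdot>\<^bsub>A\<^esub> far G f) \<cdot>\<^bsub>A\<^esub> ncomp \<eta> x"
    using A.comp_assoc[OF ncomp_hom[OF \<eta> xy(1)] far_hom[OF G f] ncomp_hom[OF \<theta> xy(2)]]
      ncomp_natural[OF \<eta> f] by simp
  also have "\<dots> = far H f \<cdot>\<^bsub>A\<^esub> (ncomp \<theta> x \<cdot>\<^bsub>A\<^esub> ncomp \<eta> x)"
    using A.comp_assoc[OF ncomp_hom[OF \<eta> xy(1)] ncomp_hom[OF \<theta> xy(1)] far_hom[OF H f]]
      ncomp_natural[OF \<theta> f] by simp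
  finally show "ncomp (\<theta> \<cdot>\<^bsub>Fct M A\<^esub> \<eta>) y \<cdot>\<^bsub>A\<^esub> far F f = far H f \<cdot>\<^bsub>A\<^esub> ncomp (\<theta> \<cdot>\<^bsub>Fct M A\<^esub> \<eta>) x"
    using xy by simp
qed (use assms Fct_ncomp_extensional(2) in \<open>simp_all add: Hom_Fct_iff\<close>)

sublocale Fct: category "Fct M A"
proof
  fix F G H K \<eta> \<theta> \<zeta>
  show "\<eta> \<in> Arr (Fct M A) \<Longrightarrow> Dom (Fct M A) \<eta> \<in> Obj (Fct M A)"
    "\<eta> \<in> Arr (Fct M A) \<Longrightarrow> Cod (Fct M A) \<eta> \<in> Obj (Fct M A)"
    by (simp_all add: ntranss_def)
  show "F \<in> Obj (Fct M A) \<Longrightarrow> Id (Fct M A) F \<in> Hom (Fct M A) F F"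
    using Fct_id_hom by simp
  show "\<eta> \<in> Hom (Fct M A) F G \<Longrightarrow> \<theta> \<in> Hom (Fct M A) G H \<Longrightarrow>
      \<theta> \<cdot>\<^bsub>Fct M A\<^esub> \<eta> \<in> Hom (Fct M A) F H"
    by (rule Fct_comp_hom)
  assume \<eta>: "\<eta> \<in> Hom (Fct M A) F G"
  have FG: "F \<in> functors M A" "G \<in> functors M A"
    using Hom_Fct_functors[OF \<eta>] by auto
  show "\<eta> \<cdot>\<^bsub>Fct M A\<^esub> Id (Fct M A) F = \<eta>"
    by (rule ntrans_eqI[OF Fct_comp_hom[OF Fct_id_hom[OF FG(1)] \<eta>] \<eta>])
      (use A.comp_id[OF ncomp_hom[OF \<eta>]] in simp)
  show "Id (Fct M A) G \<cdot>\<^bsub>Fct M A\<^esub> \<eta> = \<eta>"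
    by (rule ntrans_eqI[OF Fct_comp_hom[OF \<eta> Fct_id_hom[OF FG(2)]] \<eta>])
      (use A.id_comp[OF ncomp_hom[OF \<eta>]] in simp)
  assume \<theta>: "\<theta> \<in> Hom (Fct M A) G H" and \<zeta>: "\<zeta> \<in> Hom (Fct M A) H K"
  show "(\<zeta> \<cdot>\<^bsub>Fct M A\<^esub> \<theta>) \<cdot>\<^bsub>Fct M A\<^esub> \<eta> = \<zeta> \<cdot>\<^bsub>Fct M A\<^esub> (\<theta> \<cdot>\<^bsub>Fct M A\<^esub> \<eta>)"
    by (rule ntrans_eqI[OF Fct_comp_hom[OF \<eta> Fct_comp_hom[OF \<theta> \<zeta>]]
          Fct_comp_hom[OF Fct_comp_hom[OF \<eta> \<theta>] \<zeta>]])
      (use A.comp_assoc[OF ncomp_hom[OF \<eta>] ncomp_hom[OF \<theta>] ncomp_hom[OF \<zeta>]] in simp)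
qed

section \<open>Null objects and zero arrows of \<open>Fct M A\<close>, object by object\<close>

lemma null_object_FctI:
  assumes F: "F \<in> functors M A" and null: "\<And>x. x \<in> Obj M \<Longrightarrow> null_object A (fob F x)"
  shows "null_object (Fct M A) F"
proof -
  have from_null: "u = v" if "u \<in> Hom A (fob F x) Y" "v \<in> Hom A (fob F x) Y" "x \<in> Obj M" for u v x Y
    using that null A.initial_unique unfolding null_object_def by blast
  have to_null: "u = v" if "u \<in> Hom A Y (fob F x)" "v \<in> Hom A Y (fob F x)" "x \<in> Obj M" for u v x Y
    using that null A.terminal_unique unfolding null_object_def by blast
  have "(\<exists>!\<eta>. \<eta> \<in> Hom (Fct M A) F G) \<and> (\<exists>!\<eta>. \<eta> \<in> Hom (Fct M A) G F)"
    if G: "G \<in> functors M A" for G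
  proof
    have "\<exists>t. t \<in> Hom A (fob F x) (fob G x)" if "x \<in> Obj M" for x
      using null_object_from[OF null fob_obj[OF G]] that by blast
    then obtain t where t: "t x \<in> Hom A (fob F x) (fob G x)" if "x \<in> Obj M" for x
      by metis
    \<comment> \<open>Both sides are arrows out of a null object, so any choice of components is
      natural.\<close>
    have natural: "t y \<cdot>\<^bsub>A\<^esub> far F f = far G f \<cdot>\<^bsub>A\<^esub> t x" if f: "f \<in> Hom M x y" for f x y
      using from_null A.comp_hom[OF far_hom[OF F f] t] A.comp_hom[OF t far_hom[OF G f]]
        M.Hom_obj[OF f] by blast
    obtain \<eta> where "\<eta> \<in> Hom (Fct M A) F G"
      by (rule ntrans_exists[OF F G, of t]) (use t natural in blast)+
    moreover have "\<eta> = \<theta>" if "\<eta> \<in> Hom (Fct M A) F G" "\<theta> \<in> Hom (Fct M A) F G" for \<eta> \<theta>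
      using ntrans_eqI[OF that] from_null ncomp_hom[OF that(1)] ncomp_hom[OF that(2)] by blast
    ultimately show "\<exists>!\<eta>. \<eta> \<in> Hom (Fct M A) F G"
      by blast
  next
    have "\<exists>t. t \<in> Hom A (fob G x) (fob F x)" if "x \<in> Obj M" for x
      using null_object_to[OF null fob_obj[OF G]] that by blast
    then obtain t where t: "t x \<in> Hom A (fob G x) (fob F x)" if "x \<in> Obj M" for x
      by metis
    have natural: "t y \<cdot>\<^bsub>A\<^esub> far G f = far F f \<cdot>\<^bsub>A\<^esub> t x" if f: "f \<in> Hom M x y" for f x y
      using to_null A.comp_hom[OF far_hom[OF G f] t] A.comp_hom[OF t far_hom[OF F f]]
        M.Hom_obj[OF f] by blast
    obtain \<eta> where "\<eta> \<in> Hom (Fct M A) G F"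
      by (rule ntrans_exists[OF G F, of t]) (use t natural in blast)+
    moreover have "\<eta> = \<theta>" if "\<eta> \<in> Hom (Fct M A) G F" "\<theta> \<in> Hom (Fct M A) G F" for \<eta> \<theta>
      using ntrans_eqI[OF that] to_null ncomp_hom[OF that(1)] ncomp_hom[OF that(2)] by blast
    ultimately show "\<exists>!\<eta>. \<eta> \<in> Hom (Fct M A) G F"
      by blast
  qed
  then show ?thesis
    using F unfolding null_object_def initial_object_def terminal_object_def by simp
qed

lemma null_object_Fct_exists:
  assumes "null_object A Z"
  obtains F where "null_object (Fct M A) F" "\<And>x. x \<in> Obj M \<Longrightarrow> fob F x = Z"
proof -
  let ?F = "\<lparr>fob = (\<lambda>x\<in>Obj M. Z), far = (\<lambda>f\<in>Arr M. Id A Z)\<rparr>"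
  have Id: "Id A Z \<in> Hom A Z Z"
    using A.id_hom null_object_obj[OF assms] by simp
  have "?F \<in> functors M A"
  proof (rule functorsI)
    show "far ?F f \<in> Hom A (fob ?F x) (fob ?F y)" if "f \<in> Hom M x y" for f x y
      using that Id M.Hom_obj[OF that] by (simp add: Hom_iff)
    show "far ?F (Id M x) = Id A (fob ?F x)" if "x \<in> Obj M" for x
      using that M.id_hom[OF that] by (simp add: Hom_iff)
    show "far ?F (g \<cdot>\<^bsub>M\<^esub> f) = far ?F g \<cdot>\<^bsub>A\<^esub> far ?F f" if "f \<in> Hom M x y" "g \<in> Hom M y z" for f g x y z
      using that M.comp_hom[OF that] A.comp_id[OF Id] by (simp add: Hom_iff)
  qed (use null_object_obj[OF assms] in simp_all)
  then show ?thesis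
    using that[of ?F] null_object_FctI[of ?F] assms by simp
qed

text \<open>\<open>F\<close> is compared with the constant functor at \<open>Z\<close>: both are
  null, so they are isomorphic, and evaluation at \<open>x\<close> exhibits \<open>fob F x\<close>
  as a retract of \<open>Z\<close>.\<close>

lemma null_object_FctD:
  assumes "null_object A Z" "null_object (Fct M A) F" "x \<in> Obj M"
  shows "null_object A (fob F x)"
proof -
  obtain G where G: "null_object (Fct M A) G" "fob G x = Z"
    using null_object_Fct_exists[OF assms(1)] assms(3) by metis
  obtain \<eta> where \<eta>: "\<eta> \<in> Hom (Fct M A) F G"
    using null_object_from[OF assms(2) null_object_obj[OF G(1)]] .
  obtain \<theta> where \<theta>: "\<theta> \<in> Hom (Fct M A) G F"
    using null_object_to[OF assms(2) null_object_obj[OF G(1)]] .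
  have "\<theta> \<cdot>\<^bsub>Fct M A\<^esub> \<eta> = Id (Fct M A) F"
    using Fct.initial_unique Fct.comp_hom[OF \<eta> \<theta>] Fct.id_hom null_object_obj[OF assms(2)] assms(2)
    unfolding null_object_def by blast
  then have "ncomp \<theta> x \<cdot>\<^bsub>A\<^esub> ncomp \<eta> x = Id A (fob F x)"
    using assms(3) Fct_simps(9,10) by metis
  then show ?thesis
    using A.null_object_retract[OF assms(1)] ncomp_hom[OF \<eta> assms(3)] ncomp_hom[OF \<theta> assms(3)]
    unfolding G(2) by blast
qed

text \<open>Factorizations of the components through null objects of \<open>A\<close> are unrelated
  for different \<open>x\<close>. The converse therefore compares \<open>\<eta>\<close> with a zero
  transformation \<open>\<zeta>\<close>, whose components are parallel zero arrows.\<close>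

lemma zero_arrow_Fct_iff:
  assumes Z: "null_object A Z" and \<eta>: "\<eta> \<in> Hom (Fct M A) F G"
  shows "zero_arrow (Fct M A) \<eta> \<longleftrightarrow> (\<forall>x\<in>Obj M. zero_arrow A (ncomp \<eta> x))"
proof -
  have zero: "zero_arrow A (ncomp \<theta> x)"
    if \<theta>: "zero_arrow (Fct M A) \<theta>" "\<theta> \<in> Hom (Fct M A) F G" and x: "x \<in> Obj M" for \<theta> x
  proof -
    obtain N p i where N: "null_object (Fct M A) N" "p \<in> Hom (Fct M A) F N"
        "i \<in> Hom (Fct M A) N G" "\<theta> = i \<cdot>\<^bsub>Fct M A\<^esub> p"
      using \<theta> by (elim Fct.zero_arrowE)
    then show ?thesis
      using A.zero_arrowI[OF null_object_FctD[OF Z N(1) x] ncomp_hom[OF N(2) x] ncomp_hom[OF N(3) x]] x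
      by simp
  qed
  obtain N where "null_object (Fct M A) N"
    using null_object_Fct_exists[OF Z] by metis
  then obtain \<zeta> where \<zeta>: "\<zeta> \<in> Hom (Fct M A) F G" "zero_arrow (Fct M A) \<zeta>"
    using Fct.zero_arrow_exists Fct.Hom_obj[OF \<eta>] by metis
  show ?thesis
  proof
    show "zero_arrow (Fct M A) \<eta> \<Longrightarrow> \<forall>x\<in>Obj M. zero_arrow A (ncomp \<eta> x)"
      using zero \<eta> by blast
    assume *: "\<forall>x\<in>Obj M. zero_arrow A (ncomp \<eta> x)"
    have "\<eta> = \<zeta>"
      using ntrans_eqI[OF \<eta> \<zeta>(1)] A.zero_arrow_unique * zero[OF \<zeta>(2,1)]
        ncomp_hom[OF \<eta>] ncomp_hom[OF \<zeta>(1)] by metis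
    then show "zero_arrow (Fct M A) \<eta>"
      using \<zeta> by simp
  qed
qed

text \<open>This turns kernels chosen separately at each object into a functor: the unique
  factorization defines the action on arrows and, by uniqueness again, forces functoriality.\<close>

lemma subfunctor_exists:
  assumes F: "F \<in> functors M A"
    and k: "\<And>x. x \<in> Obj M \<Longrightarrow> k x \<in> Hom A (P x) (fob F x)"
    and factor: "\<And>x y f. f \<in> Hom M x y \<Longrightarrow>
      \<exists>!u. u \<in> Hom A (P x) (P y) \<and> k y \<cdot>\<^bsub>A\<^esub> u = far F f \<cdot>\<^bsub>A\<^esub> k x"
  obtains K \<kappa> where "\<kappa> \<in> Hom (Fct M A) K F" "\<And>x. x \<in> Obj M \<Longrightarrow> ncomp \<kappa> x = k x"
proof -
  define \<phi> where "\<phi> f = (THE u. u \<in> Hom A (P (Dom M f)) (P (Cod M f)) \<and>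
      k (Cod M f) \<cdot>\<^bsub>A\<^esub> u = far F f \<cdot>\<^bsub>A\<^esub> k (Dom M f))" for f
  have \<phi>: "\<phi> f \<in> Hom A (P x) (P y)" "k y \<cdot>\<^bsub>A\<^esub> \<phi> f = far F f \<cdot>\<^bsub>A\<^esub> k x" if "f \<in> Hom M x y" for f x y
    using theI'[OF factor[OF that]] that unfolding \<phi>_def Hom_iff by auto
  have \<phi>_eq: "\<phi> f = u"
    if "f \<in> Hom M x y" "u \<in> Hom A (P x) (P y)" "k y \<cdot>\<^bsub>A\<^esub> u = far F f \<cdot>\<^bsub>A\<^esub> k x" for f x y u
    using factor[OF that(1)] \<phi>[OF that(1)] that(2,3) by blast
  let ?K = "\<lparr>fob = (\<lambda>x\<in>Obj M. P x), far = (\<lambda>f\<in>Arr M. \<phi> f)\<rparr>"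
  have K: "?K \<in> functors M A"
  proof (rule functorsI)
    show "fob ?K x \<in> Obj A" if "x \<in> Obj M" for x
      using that A.Hom_obj[OF k[OF that]] by simp
    show "far ?K f \<in> Hom A (fob ?K x) (fob ?K y)" if "f \<in> Hom M x y" for f x y
      using \<phi>(1)[OF that] M.Hom_obj[OF that] that by (simp add: Hom_iff)
    show "far ?K (Id M x) = Id A (fob ?K x)" if x: "x \<in> Obj M" for x
    proof -
      note Id = M.id_hom[OF x]
      have "Id A (P x) \<in> Hom A (P x) (P x)"
        using A.Hom_obj[OF k[OF x]] A.id_hom by simp
      moreover have "k x \<cdot>\<^bsub>A\<^esub> Id A (P x) = far F (Id M x) \<cdot>\<^bsub>A\<^esub> k x"
        using A.comp_id[OF k[OF x]] A.id_comp[OF k[OF x]] far_id[OF F x] by simp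
      ultimately show ?thesis
        using \<phi>_eq[OF Id] x Id by (simp add: Hom_iff)
    qed
    show "far ?K (g \<cdot>\<^bsub>M\<^esub> f) = far ?K g \<cdot>\<^bsub>A\<^esub> far ?K f"
      if f: "f \<in> Hom M x y" and g: "g \<in> Hom M y z" for f g x y z
    proof -
      have o: "x \<in> Obj M" "y \<in> Obj M" "z \<in> Obj M"
        using M.Hom_obj f g by auto
      have "k z \<cdot>\<^bsub>A\<^esub> (\<phi> g \<cdot>\<^bsub>A\<^esub> \<phi> f) = (far F g \<cdot>\<^bsub>A\<^esub> k y) \<cdot>\<^bsub>A\<^esub> \<phi> f"
        using A.comp_assoc[OF \<phi>(1)[OF f] \<phi>(1)[OF g] k[OF o(3)]] \<phi>(2)[OF g] by simp
      also have "\<dots> = far F g \<cdot>\<^bsub>A\<^esub> (far F f \<cdot>\<^bsub>A\<^esub> k x)"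
        using A.comp_assoc[OF \<phi>(1)[OF f] k[OF o(2)] far_hom[OF F g]] \<phi>(2)[OF f] by simp
      also have "\<dots> = far F (g \<cdot>\<^bsub>M\<^esub> f) \<cdot>\<^bsub>A\<^esub> k x"
        using A.comp_assoc[OF k[OF o(1)] far_hom[OF F f] far_hom[OF F g]] far_comp[OF F f g] by simp
      finally have "\<phi> (g \<cdot>\<^bsub>M\<^esub> f) = \<phi> g \<cdot>\<^bsub>A\<^esub> \<phi> f"
        using \<phi>_eq[OF M.comp_hom[OF f g] A.comp_hom[OF \<phi>(1)[OF f] \<phi>(1)[OF g]]] by simp
      then show ?thesis
        using f g M.comp_hom[OF f g] by (simp add: Hom_iff)
    qed
  qed simp_all
  have "k y \<cdot>\<^bsub>A\<^esub> far ?K f = far F f \<cdot>\<^bsub>A\<^esub> k x" if "f \<in> Hom M x y" for f x y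
    using \<phi>(2)[OF that] that by (simp add: Hom_iff)
  moreover have "k x \<in> Hom A (fob ?K x) (fob F x)" if "x \<in> Obj M" for x
    using k that by simp
  ultimately obtain \<kappa> where "\<kappa> \<in> Hom (Fct M A) ?K F" "\<And>x. x \<in> Obj M \<Longrightarrow> ncomp \<kappa> x = k x"
    using ntrans_exists[OF K F, of k] by blast
  then show ?thesis
    using that by blast
qed

text \<open>Dual of \<open>subfunctor_exists\<close>, meant for cokernels chosen separately at each
  object.\<close>

lemma quotient_functor_exists:
  assumes F: "F \<in> functors M A"
    and c: "\<And>x. x \<in> Obj M \<Longrightarrow> c x \<in> Hom A (fob F x) (P x)"
    and factor: "\<And>x y f. f \<in> Hom M x y \<Longrightarrow>
      \<exists>!u. u \<in> Hom A (P x) (P y) \<and> u \<cdot>\<^bsub>A\<^esub> c x = c y \<cdot>\<^bsub>A\<^esub> far F f"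
  obtains Q \<gamma> where "\<gamma> \<in> Hom (Fct M A) F Q" "\<And>x. x \<in> Obj M \<Longrightarrow> ncomp \<gamma> x = c x"
proof -
  define \<phi> where "\<phi> f = (THE u. u \<in> Hom A (P (Dom M f)) (P (Cod M f)) \<and>
      u \<cdot>\<^bsub>A\<^esub> c (Dom M f) = c (Cod M f) \<cdot>\<^bsub>A\<^esub> far F f)" for f
  have \<phi>: "\<phi> f \<in> Hom A (P x) (P y)" "\<phi> f \<cdot>\<^bsub>A\<^esub> c x = c y \<cdot>\<^bsub>A\<^esub> far F f" if "f \<in> Hom M x y" for f x y
    using theI'[OF factor[OF that]] that unfolding \<phi>_def Hom_iff by auto
  have \<phi>_eq: "\<phi> f = u"
    if "f \<in> Hom M x y" "u \<in> Hom A (P x) (P y)" "u \<cdot>\<^bsub>A\<^esub> c x = c y \<cdot>\<^bsub>A\<^esub> far F f" for f x y u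
    using factor[OF that(1)] \<phi>[OF that(1)] that(2,3) by blast
  let ?Q = "\<lparr>fob = (\<lambda>x\<in>Obj M. P x), far = (\<lambda>f\<in>Arr M. \<phi> f)\<rparr>"
  have Q: "?Q \<in> functors M A"
  proof (rule functorsI)
    show "fob ?Q x \<in> Obj A" if "x \<in> Obj M" for x
      using that A.Hom_obj[OF c[OF that]] by simp
    show "far ?Q f \<in> Hom A (fob ?Q x) (fob ?Q y)" if "f \<in> Hom M x y" for f x y
      using \<phi>(1)[OF that] M.Hom_obj[OF that] that by (simp add: Hom_iff)
    show "far ?Q (Id M x) = Id A (fob ?Q x)" if x: "x \<in> Obj M" for x
    proof -
      note Id = M.id_hom[OF x]
      have "Id A (P x) \<in> Hom A (P x) (P x)"
        using A.Hom_obj[OF c[OF x]] A.id_hom by simp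
      moreover have "Id A (P x) \<cdot>\<^bsub>A\<^esub> c x = c x \<cdot>\<^bsub>A\<^esub> far F (Id M x)"
        using A.comp_id[OF c[OF x]] A.id_comp[OF c[OF x]] far_id[OF F x] by simp
      ultimately show ?thesis
        using \<phi>_eq[OF Id] x Id by (simp add: Hom_iff)
    qed
    show "far ?Q (g \<cdot>\<^bsub>M\<^esub> f) = far ?Q g \<cdot>\<^bsub>A\<^esub> far ?Q f"
      if f: "f \<in> Hom M x y" and g: "g \<in> Hom M y z" for f g x y z
    proof -
      have o: "x \<in> Obj M" "y \<in> Obj M" "z \<in> Obj M"
        using M.Hom_obj f g by auto
      have "(\<phi> g \<cdot>\<^bsub>A\<^esub> \<phi> f) \<cdot>\<^bsub>A\<^esub> c x = \<phi> g \<cdot>\<^bsub>A\<^esub> (c y \<cdot>\<^bsub>A\<^esub> far F f)"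
        using A.comp_assoc[OF c[OF o(1)] \<phi>(1)[OF f] \<phi>(1)[OF g]] \<phi>(2)[OF f] by simp
      also have "\<dots> = (c z \<cdot>\<^bsub>A\<^esub> far F g) \<cdot>\<^bsub>A\<^esub> far F f"
        using A.comp_assoc[OF far_hom[OF F f] c[OF o(2)] \<phi>(1)[OF g]] \<phi>(2)[OF g] by simp
      also have "\<dots> = c z \<cdot>\<^bsub>A\<^esub> far F (g \<cdot>\<^bsub>M\<^esub> f)"
        using A.comp_assoc[OF far_hom[OF F f] far_hom[OF F g] c[OF o(3)]] far_comp[OF F f g] by simp
      finally have "\<phi> (g \<cdot>\<^bsub>M\<^esub> f) = \<phi> g \<cdot>\<^bsub>A\<^esub> \<phi> f"
        using \<phi>_eq[OF M.comp_hom[OF f g] A.comp_hom[OF \<phi>(1)[OF f] \<phi>(1)[OF g]]] by simp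
      then show ?thesis
        using f g M.comp_hom[OF f g] by (simp add: Hom_iff)
    qed
  qed simp_all
  have "c y \<cdot>\<^bsub>A\<^esub> far F f = far ?Q f \<cdot>\<^bsub>A\<^esub> c x" if "f \<in> Hom M x y" for f x y
    using \<phi>(2)[OF that] that by (simp add: Hom_iff)
  moreover have "c x \<in> Hom A (fob F x) (fob ?Q x)" if "x \<in> Obj M" for x
    using c that by simp
  ultimately obtain \<gamma> where "\<gamma> \<in> Hom (Fct M A) F ?Q" "\<And>x. x \<in> Obj M \<Longrightarrow> ncomp \<gamma> x = c x"
    using ntrans_exists[OF F Q, of c] by blast
  then show ?thesis
    using that by blast
qed

lemma iso_mod_null_Fct:
  assumes A: "abelian_category A"
    and s: "s \<in> iso_mod (Fct M A) {F. null_object (Fct M A) F}"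
  shows "iso_arrow (Fct M A) s"
proof -
  obtain Z where Z: "null_object A Z"
    using A unfolding abelian_category_def by blast
  have add: "preadditive A"
    using A unfolding abelian_category_def by blast
  define F G where "F = ndom s" and "G = ncod s"
  have s_hom: "s \<in> Hom (Fct M A) F G"
    using s unfolding iso_mod_def F_def G_def by (simp add: Hom_Fct_iff)
  then have FG: "F \<in> functors M A" "G \<in> functors M A"
    using Hom_Fct_functors by auto
  note sx = ncomp_hom[OF s_hom]
  obtain \<kappa> where \<kappa>: "is_kernel (Fct M A) s \<kappa>" "null_object (Fct M A) (ndom \<kappa>)"
    using s unfolding iso_mod_def by auto
  obtain \<gamma> where \<gamma>: "is_cokernel (Fct M A) s \<gamma>" "null_object (Fct M A) (ncod \<gamma>)"
    using s unfolding iso_mod_def by auto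
  have arr: "ncomp s x \<in> Arr A" if "x \<in> Obj M" for x
    using sx[OF that] by (simp add: Hom_iff)
  have monic: "monic A (ncomp s x)" if x: "x \<in> Obj M" for x
  proof -
    have "\<exists>k. is_kernel A (ncomp s x) k" if "x \<in> Obj M" for x
      using A arr[OF that] unfolding abelian_category_def by blast
    then obtain k where k: "is_kernel A (ncomp s x) (k x)" if "x \<in> Obj M" for x
      by metis
    note k_hom = A.kernel_hom[OF sx k]
    have factor: "\<exists>!u. u \<in> Hom A (Dom A (k x)) (Dom A (k y)) \<and> k y \<cdot>\<^bsub>A\<^esub> u = far F f \<cdot>\<^bsub>A\<^esub> k x"
      if f: "f \<in> Hom M x y" for f x y
    proof (rule A.kernel_factor)
      have xy: "x \<in> Obj M" "y \<in> Obj M"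
        using M.Hom_obj[OF f] by auto
      show "is_kernel A (ncomp s y) (k y)" "ncomp s y \<in> Hom A (fob F y) (fob G y)"
        using k sx xy by auto
      show "far F f \<cdot>\<^bsub>A\<^esub> k x \<in> Hom A (Dom A (k x)) (fob F y)"
        using A.comp_hom[OF k_hom(1) far_hom[OF FG(1) f]] xy by blast
      \<comment> \<open>Naturality of \<open>s\<close> shows that \<open>far F f\<close> carries the
        kernel at \<open>x\<close> into the kernel at \<open>y\<close>.\<close>
      have "ncomp s y \<cdot>\<^bsub>A\<^esub> (far F f \<cdot>\<^bsub>A\<^esub> k x) = far G f \<cdot>\<^bsub>A\<^esub> (ncomp s x \<cdot>\<^bsub>A\<^esub> k x)"
        using A.comp_assoc[OF k_hom(1) far_hom[OF FG(1) f] sx] ncomp_natural[OF s_hom f]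
          A.comp_assoc[OF k_hom(1) sx far_hom[OF FG(2) f]] xy by metis
      then show "zero_arrow A (ncomp s y \<cdot>\<^bsub>A\<^esub> (far F f \<cdot>\<^bsub>A\<^esub> k x))"
        using A.zero_arrow_comp_left[OF k_hom(2) A.comp_hom[OF k_hom(1) sx] far_hom[OF FG(2) f]] xy
        by simp
    qed
    obtain K k' where k': "k' \<in> Hom (Fct M A) K F" "\<And>x. x \<in> Obj M \<Longrightarrow> ncomp k' x = k x"
      by (rule subfunctor_exists[OF FG(1), of k "\<lambda>x. Dom A (k x)"]) (use k_hom(1) factor in blast)+
    \<comment> \<open>Here the null kernel enters: \<open>k'\<close> is killed by \<open>s\<close>,
      so it factors through the null source of \<open>\<kappa>\<close> and is zero.\<close>
    have "zero_arrow (Fct M A) (s \<cdot>\<^bsub>Fct M A\<^esub> k')"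
      using zero_arrow_Fct_iff[OF Z Fct.comp_hom[OF k'(1) s_hom]] k'(2) k_hom(2) by simp
    then obtain u where u: "u \<in> Hom (Fct M A) K (ndom \<kappa>)" "\<kappa> \<cdot>\<^bsub>Fct M A\<^esub> u = k'"
      using Fct.kernel_factor[OF \<kappa>(1) s_hom k'(1)] by auto
    have "\<kappa> \<in> Hom (Fct M A) (ndom \<kappa>) F"
      using Fct.kernel_hom[OF s_hom \<kappa>(1)] by simp
    then have "zero_arrow (Fct M A) k'"
      using Fct.zero_arrowI[OF \<kappa>(2) u(1)] u(2) by blast
    then have "zero_arrow A (k x)"
      using zero_arrow_Fct_iff[OF Z k'(1)] k'(2) x by simp
    then show ?thesis
      using A.monic_if_kernel_zero[OF add sx k] x by blast
  qed
  have epic: "epic A (ncomp s x)" if x: "x \<in> Obj M" for x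
  proof -
    have "\<exists>c. is_cokernel A (ncomp s x) c" if "x \<in> Obj M" for x
      using A arr[OF that] unfolding abelian_category_def by blast
    then obtain c where c: "is_cokernel A (ncomp s x) (c x)" if "x \<in> Obj M" for x
      by metis
    note c_hom = A.cokernel_hom[OF sx c]
    have factor: "\<exists>!u. u \<in> Hom A (Cod A (c x)) (Cod A (c y)) \<and> u \<cdot>\<^bsub>A\<^esub> c x = c y \<cdot>\<^bsub>A\<^esub> far G f"
      if f: "f \<in> Hom M x y" for f x y
    proof (rule A.cokernel_factor)
      have xy: "x \<in> Obj M" "y \<in> Obj M"
        using M.Hom_obj[OF f] by auto
      show "is_cokernel A (ncomp s x) (c x)" "ncomp s x \<in> Hom A (fob F x) (fob G x)"
        using c sx xy by auto
      show "c y \<cdot>\<^bsub>A\<^esub> far G f \<in> Hom A (fob G x) (Cod A (c y))"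
        using A.comp_hom[OF far_hom[OF FG(2) f] c_hom(1)] xy by blast
      have "(c y \<cdot>\<^bsub>A\<^esub> far G f) \<cdot>\<^bsub>A\<^esub> ncomp s x = (c y \<cdot>\<^bsub>A\<^esub> ncomp s y) \<cdot>\<^bsub>A\<^esub> far F f"
        using A.comp_assoc[OF sx far_hom[OF FG(2) f] c_hom(1)] ncomp_natural[OF s_hom f]
          A.comp_assoc[OF far_hom[OF FG(1) f] sx c_hom(1)] xy by metis
      then show "zero_arrow A ((c y \<cdot>\<^bsub>A\<^esub> far G f) \<cdot>\<^bsub>A\<^esub> ncomp s x)"
        using A.zero_arrow_comp_right[OF c_hom(2) far_hom[OF FG(1) f] A.comp_hom[OF sx c_hom(1)]] xy
        by simp
    qed
    obtain Q c' where c': "c' \<in> Hom (Fct M A) G Q" "\<And>x. x \<in> Obj M \<Longrightarrow> ncomp c' x = c x"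
      by (rule quotient_functor_exists[OF FG(2), of c "\<lambda>x. Cod A (c x)"]) (use c_hom(1) factor in blast)+
    have "zero_arrow (Fct M A) (c' \<cdot>\<^bsub>Fct M A\<^esub> s)"
      using zero_arrow_Fct_iff[OF Z Fct.comp_hom[OF s_hom c'(1)]] c'(2) c_hom(2) by simp
    then obtain u where u: "u \<in> Hom (Fct M A) (ncod \<gamma>) Q" "u \<cdot>\<^bsub>Fct M A\<^esub> \<gamma> = c'"
      using Fct.cokernel_factor[OF \<gamma>(1) s_hom c'(1)] by auto
    have "\<gamma> \<in> Hom (Fct M A) G (ncod \<gamma>)"
      using Fct.cokernel_hom[OF s_hom \<gamma>(1)] by simp
    then have "zero_arrow (Fct M A) c'"
      using Fct.zero_arrowI[OF \<gamma>(2) _ u(1)] u(2) by blast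
    then have "zero_arrow A (c x)"
      using zero_arrow_Fct_iff[OF Z c'(1)] c'(2) x by simp
    then show ?thesis
      using A.epic_if_cokernel_zero[OF add sx c] x by blast
  qed
  have "\<exists>t. t \<in> Hom A (fob G x) (fob F x) \<and> t \<cdot>\<^bsub>A\<^esub> ncomp s x = Id A (fob F x) \<and>
      ncomp s x \<cdot>\<^bsub>A\<^esub> t = Id A (fob G x)" if "x \<in> Obj M" for x
    using A.abelian_balanced[OF A monic[OF that] epic[OF that] sx[OF that]] by blast
  then obtain t where t: "t x \<in> Hom A (fob G x) (fob F x)" "t x \<cdot>\<^bsub>A\<^esub> ncomp s x = Id A (fob F x)"
      "ncomp s x \<cdot>\<^bsub>A\<^esub> t x = Id A (fob G x)" if "x \<in> Obj M" for x
    by metis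
  have natural: "t y \<cdot>\<^bsub>A\<^esub> far G f = far F f \<cdot>\<^bsub>A\<^esub> t x" if f: "f \<in> Hom M x y" for f x y
  proof -
    have xy: "x \<in> Obj M" "y \<in> Obj M"
      using M.Hom_obj[OF f] by auto
    note Ff = far_hom[OF FG(1) f] and Gf = far_hom[OF FG(2) f]
    note tx = t[OF xy(1)] and ty = t[OF xy(2)]
    have "t y \<cdot>\<^bsub>A\<^esub> far G f = t y \<cdot>\<^bsub>A\<^esub> (far G f \<cdot>\<^bsub>A\<^esub> (ncomp s x \<cdot>\<^bsub>A\<^esub> t x))"
      using tx(3) A.comp_id[OF Gf] by simp
    also have "\<dots> = t y \<cdot>\<^bsub>A\<^esub> ((ncomp s y \<cdot>\<^bsub>A\<^esub> far F f) \<cdot>\<^bsub>A\<^esub> t x)"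
      using A.comp_assoc[OF tx(1) sx[OF xy(1)] Gf] ncomp_natural[OF s_hom f] by simp
    also have "\<dots> = t y \<cdot>\<^bsub>A\<^esub> (ncomp s y \<cdot>\<^bsub>A\<^esub> (far F f \<cdot>\<^bsub>A\<^esub> t x))"
      using A.comp_assoc[OF tx(1) Ff sx[OF xy(2)]] by simp
    also have "\<dots> = (t y \<cdot>\<^bsub>A\<^esub> ncomp s y) \<cdot>\<^bsub>A\<^esub> (far F f \<cdot>\<^bsub>A\<^esub> t x)"
      using A.comp_assoc[OF A.comp_hom[OF tx(1) Ff] sx[OF xy(2)] ty(1)] by simp
    also have "\<dots> = far F f \<cdot>\<^bsub>A\<^esub> t x"
      using ty(2) A.id_comp[OF A.comp_hom[OF tx(1) Ff]] by simp
    finally show ?thesis .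
  qed
  obtain \<theta> where \<theta>: "\<theta> \<in> Hom (Fct M A) G F" "\<And>x. x \<in> Obj M \<Longrightarrow> ncomp \<theta> x = t x"
    by (rule ntrans_exists[OF FG(2,1), of t]) (use t natural in blast)+
  have "\<theta> \<cdot>\<^bsub>Fct M A\<^esub> s = Id (Fct M A) F"
    by (rule ntrans_eqI[OF Fct_comp_hom[OF s_hom \<theta>(1)] Fct_id_hom[OF FG(1)]]) (simp add: \<theta>(2) t)
  moreover have "s \<cdot>\<^bsub>Fct M A\<^esub> \<theta> = Id (Fct M A) G"
    by (rule ntrans_eqI[OF Fct_comp_hom[OF \<theta>(1) s_hom] Fct_id_hom[OF FG(2)]]) (simp add: \<theta>(2) t)
  ultimately show ?thesis
    using s_hom \<theta>(1) unfolding iso_arrow_def F_def G_def by (auto simp: Hom_Fct_iff)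
qed

end

section \<open>Functors on a monoidal category with null unit\<close>

locale null_unit_functors =
  M: strict_symmetric_monoidal M + A: category A
  for M :: "('o, 'a, 'y) moncat_scheme" and A :: "('p, 'b, 'z) cat_scheme" +
  assumes null_unit: "null_object M (unit_obj M)"
begin

sublocale functor_category M A ..

section \<open>The map from \<open>F\<close> to its translate, and its kernel\<close>

lemma from_unit_hom:
  assumes "x \<in> Obj M"
  shows "from_unit M x \<in> Hom M (unit_obj M) x"
proof -
  have "\<exists>!f. f \<in> Hom M (unit_obj M) x"
    using assms null_unit unfolding null_object_def initial_object_def by blast
  then show ?thesis
    unfolding from_unit_def by (rule theI')
qed

text \<open>Strictness identifies the sum of the unit and \<open>y\<close> with \<open>y\<close>
  itself, so that \<open>F\<close> can be applied without coherence isomorphisms.\<close>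

lemma from_unit_aplus_hom:
  assumes "x \<in> Obj M" "y \<in> Obj M"
  shows "aplus M (from_unit M x) (Id M y) \<in> Hom M y (oplus M x y)"
  using M.aplus_hom[OF from_unit_hom[OF assms(1)] M.id_hom[OF assms(2)]]
    M.oplus_unit_left[OF assms(2)] by simp

lemma tau_obj_functor:
  assumes F: "F \<in> functors M A" and x: "x \<in> Obj M"
  shows "tau_obj M x F \<in> functors M A"
proof (rule functorsI)
  have aplus: "aplus M (Id M x) f \<in> Hom M (oplus M x y) (oplus M x z)" if "f \<in> Hom M y z" for f y z
    using M.aplus_hom[OF M.id_hom[OF x] that] .
  show "fob (tau_obj M x F) y \<in> Obj A" if "y \<in> Obj M" for y
    using that fob_obj[OF F] M.oplus_obj[OF x] by (simp add: tau_obj_def)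
  show "far (tau_obj M x F) f \<in> Hom A (fob (tau_obj M x F) y) (fob (tau_obj M x F) z)"
    if "f \<in> Hom M y z" for f y z
    using far_hom[OF F aplus[OF that]] that M.Hom_obj[OF that] by (simp add: tau_obj_def Hom_iff)
  show "far (tau_obj M x F) (Id M y) = Id A (fob (tau_obj M x F) y)" if "y \<in> Obj M" for y
    using that M.id_hom[OF that] M.aplus_id[OF x that] far_id[OF F M.oplus_obj[OF x that]]
    by (simp add: tau_obj_def Hom_iff)
  show "far (tau_obj M x F) (g \<cdot>\<^bsub>M\<^esub> f) = far (tau_obj M x F) g \<cdot>\<^bsub>A\<^esub> far (tau_obj M x F) f"
    if f: "f \<in> Hom M y z" and g: "g \<in> Hom M z w" for f g y z w
  proof -
    have "aplus M (Id M x) (g \<cdot>\<^bsub>M\<^esub> f) = aplus M (Id M x) g \<cdot>\<^bsub>M\<^esub> aplus M (Id M x) f"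
      using M.aplus_comp[OF M.id_hom[OF x] M.id_hom[OF x] f g] M.comp_id[OF M.id_hom[OF x]] by simp
    then show ?thesis
      using f g M.comp_hom[OF f g] far_comp[OF F aplus[OF f] aplus[OF g]]
      by (simp add: tau_obj_def Hom_iff)
  qed
qed (simp_all add: tau_obj_def)

text \<open>Naturality is the interchange law: strict unitality writes \<open>f\<close> as its sum
  with the identity of the unit, and both composites then equal the sum of
  \<open>from_unit M x\<close> with \<open>f\<close>.\<close>

lemma shift_map_hom:
  assumes F: "F \<in> functors M A" and x: "x \<in> Obj M"
  shows "shift_map M x F \<in> Hom (Fct M A) F (tau_obj M x F)"
proof (rule Hom_FctI[OF F tau_obj_functor[OF F x]])
  show "ncomp (shift_map M x F) y \<in> Hom A (fob F y) (fob (tau_obj M x F) y)" if "y \<in> Obj M" for y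
    using that far_hom[OF F from_unit_aplus_hom[OF x that]] by (simp add: shift_map_def tau_obj_def)
  fix y z f
  assume f: "f \<in> Hom M y z"
  then have yz: "y \<in> Obj M" "z \<in> Obj M"
    using M.Hom_obj by auto
  let ?i = "from_unit M x"
  note i = from_unit_hom[OF x]
  have "aplus M ?i (Id M z) \<cdot>\<^bsub>M\<^esub> f = aplus M ?i (Id M z) \<cdot>\<^bsub>M\<^esub> aplus M (Id M (unit_obj M)) f"
    using M.aplus_unit_left f by (simp add: Hom_iff)
  also have "\<dots> = aplus M ?i f"
    using M.aplus_comp[OF M.id_hom[OF M.unit_obj] i f M.id_hom[OF yz(2)]]
      M.comp_id[OF i] M.id_comp[OF f] by simp
  also have "\<dots> = aplus M (Id M x) f \<cdot>\<^bsub>M\<^esub> aplus M ?i (Id M y)"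
    using M.aplus_comp[OF i M.id_hom[OF x] M.id_hom[OF yz(1)] f] M.id_comp[OF i] M.comp_id[OF f]
    by simp
  finally have "far F (aplus M ?i (Id M z)) \<cdot>\<^bsub>A\<^esub> far F f =
      far F (aplus M (Id M x) f) \<cdot>\<^bsub>A\<^esub> far F (aplus M ?i (Id M y))"
    using far_comp[OF F f from_unit_aplus_hom[OF x yz(2)]]
      far_comp[OF F from_unit_aplus_hom[OF x yz(1)] M.aplus_hom[OF M.id_hom[OF x] f]] by simp
  then show "ncomp (shift_map M x F) z \<cdot>\<^bsub>A\<^esub> far F f =
      far (tau_obj M x F) f \<cdot>\<^bsub>A\<^esub> ncomp (shift_map M x F) y"
    using f yz by (simp add: shift_map_def tau_obj_def Hom_iff)
qed (simp_all add: shift_map_def)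

lemma shift_map_monic:
  assumes F: "F \<in> functors M A" and x: "x \<in> Obj M"
  shows "monic (Fct M A) (shift_map M x F)"
proof -
  let ?s = "shift_map M x F"
  note s = shift_map_hom[OF F x]
  obtain r where r: "r \<in> Hom M x (unit_obj M)"
    using null_object_to[OF null_unit x] .
  \<comment> \<open>Cancellation in \<open>Fct M A\<close> is tested at each object, so retractions
    of the components may be chosen one \<open>y\<close> at a time.\<close>
  have retract: "\<exists>p. p \<in> Hom A (fob (tau_obj M x F) y) (fob F y) \<and>
      p \<cdot>\<^bsub>A\<^esub> ncomp ?s y = Id A (fob F y)" if y: "y \<in> Obj M" for y
  proof -
    have ry: "aplus M r (Id M y) \<in> Hom M (oplus M x y) y"
      using M.aplus_hom[OF r M.id_hom[OF y]] M.oplus_unit_left[OF y] by simp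
    have "r \<cdot>\<^bsub>M\<^esub> from_unit M x = Id M (unit_obj M)"
      using M.initial_unique M.comp_hom[OF from_unit_hom[OF x] r] M.id_hom[OF M.unit_obj] null_unit
      unfolding null_object_def by blast
    then have "aplus M r (Id M y) \<cdot>\<^bsub>M\<^esub> aplus M (from_unit M x) (Id M y) = Id M y"
      using M.aplus_comp[OF from_unit_hom[OF x] r M.id_hom[OF y] M.id_hom[OF y]]
        M.comp_id[OF M.id_hom[OF y]] M.aplus_id[OF M.unit_obj y] M.oplus_unit_left[OF y] by simp
    then have "far F (aplus M r (Id M y)) \<cdot>\<^bsub>A\<^esub> ncomp ?s y = Id A (fob F y)"
      using far_comp[OF F from_unit_aplus_hom[OF x y] ry] far_id[OF F y] y
      by (simp add: shift_map_def)
    then show ?thesis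
      using far_hom[OF F ry] y by (auto simp: tau_obj_def)
  qed
  have "\<eta> = \<theta>"
    if \<eta>: "\<eta> \<in> Hom (Fct M A) G F" and \<theta>: "\<theta> \<in> Hom (Fct M A) G F"
      and eq: "?s \<cdot>\<^bsub>Fct M A\<^esub> \<eta> = ?s \<cdot>\<^bsub>Fct M A\<^esub> \<theta>" for G \<eta> \<theta>
  proof (rule ntrans_eqI[OF \<eta> \<theta>])
    fix y
    assume y: "y \<in> Obj M"
    obtain p where p: "p \<in> Hom A (fob (tau_obj M x F) y) (fob F y)"
        "p \<cdot>\<^bsub>A\<^esub> ncomp ?s y = Id A (fob F y)"
      using retract[OF y] by blast
    have cancel: "p \<cdot>\<^bsub>A\<^esub> ncomp (?s \<cdot>\<^bsub>Fct M A\<^esub> \<zeta>) y = ncomp \<zeta> y" if "\<zeta> \<in> Hom (Fct M A) G F" for \<zeta>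
      using A.comp_assoc[OF ncomp_hom[OF that y] ncomp_hom[OF s y] p(1)] p(2)
        A.id_comp[OF ncomp_hom[OF that y]] y by simp
    show "ncomp \<eta> y = ncomp \<theta> y"
      using cancel[OF \<eta>] cancel[OF \<theta>] eq by simp
  qed
  moreover have "?s \<in> ntranss M A" "ndom ?s = F"
    using s by (auto simp: Hom_Fct_iff)
  ultimately show ?thesis
    unfolding monic_def by simp
qed

text \<open>An arrow out of a null functor is a kernel of the monic shift map, so the choice in
  \<open>kappa_incl\<close> returns a genuine kernel, and every kernel of a monic arrow has null
  source.\<close>

lemma kappa_null:
  assumes Z: "null_object A Z" and F: "F \<in> functors M A" and x: "x \<in> Obj M"
  shows "null_object (Fct M A) (ndom (kappa_incl M A x F))"
    and "kappa_incl M A x F \<in> Hom (Fct M A) (ndom (kappa_incl M A x F)) F"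
proof -
  note s = shift_map_hom[OF F x] and monic = shift_map_monic[OF F x]
  obtain N where N: "null_object (Fct M A) N"
    using null_object_Fct_exists[OF Z] by blast
  obtain k where "k \<in> Hom (Fct M A) N F"
    using null_object_from[OF N] F by auto
  then have "is_kernel (Fct M A) (shift_map M x F) k"
    using Fct.kernel_of_monic[OF monic N] s by (simp add: Hom_Fct_iff)
  then have k: "is_kernel (Fct M A) (shift_map M x F) (kappa_incl M A x F)"
    unfolding kappa_incl_def by (rule someI)
  show "null_object (Fct M A) (ndom (kappa_incl M A x F))"
    using Fct.kernel_of_monic_null[OF monic k] by simp
  show "kappa_incl M A x F \<in> Hom (Fct M A) (ndom (kappa_incl M A x F)) F"
    using Fct.kernel_hom(1)[OF s k] by simp
qed

text \<open>The supremum is tested against an arrow \<open>t\<close> from a null functor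
  \<open>N\<close> to \<open>F\<close>. It is monic and every \<open>kappa_incl M A x F\<close>
  factors through it, so the identity of \<open>F\<close> does too, and \<open>F\<close> is a
  retract of \<open>N\<close>. Conversely, every monic arrow into a null \<open>F\<close> has a
  section, so the identity is the least upper bound.\<close>

lemma stably_null_eq:
  assumes Z: "null_object A Z"
  shows "stably_null M A = {F. null_object (Fct M A) F}"
proof (intro Set.equalityI subsetI; unfold mem_Collect_eq)
  fix F
  assume "F \<in> stably_null M A"
  then have F: "F \<in> functors M A"
    and sum: "is_subobject_sum (Fct M A) F {kappa_incl M A x F | x. x \<in> Obj M} (Id (Fct M A) F)"
    unfolding stably_null_def by auto
  obtain N where N: "null_object (Fct M A) N"
    using null_object_Fct_exists[OF Z] by blast
  obtain t where t: "t \<in> Hom (Fct M A) N F"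
    using null_object_from[OF N] F by auto
  have t': "ndom t = N" "ncod t = F"
    using t by (auto simp: Hom_Fct_iff)
  have "factors_through (Fct M A) (kappa_incl M A x F) t" if x: "x \<in> Obj M" for x
  proof -
    note k = kappa_null[OF Z F x]
    obtain u where u: "u \<in> Hom (Fct M A) (ndom (kappa_incl M A x F)) N"
      using null_object_from[OF k(1) null_object_obj[OF N]] .
    have "t \<cdot>\<^bsub>Fct M A\<^esub> u = kappa_incl M A x F"
      using Fct.initial_unique Fct.comp_hom[OF u t] k unfolding null_object_def by blast
    then show ?thesis
      using u t' unfolding factors_through_def by auto
  qed
  then have "factors_through (Fct M A) (Id (Fct M A) F) t"
    using sum Fct.monic_from_null[OF N t] t' unfolding is_subobject_sum_def by auto
  then obtain u where "u \<in> Hom (Fct M A) F N" "t \<cdot>\<^bsub>Fct M A\<^esub> u = Id (Fct M A) F"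
    using t' unfolding factors_through_def by auto
  then show "null_object (Fct M A) F"
    using Fct.null_object_retract[OF N _ t] by blast
next
  fix F
  assume F: "null_object (Fct M A) F"
  then have FO: "F \<in> functors M A"
    using null_object_obj by fastforce
  have "factors_through (Fct M A) (kappa_incl M A x F) (Id (Fct M A) F)" if x: "x \<in> Obj M" for x
    using kappa_null(2)[OF Z FO x] Fct.id_comp[OF kappa_null(2)[OF Z FO x]]
    unfolding factors_through_def by auto
  moreover have "factors_through (Fct M A) (Id (Fct M A) F) t"
    if t: "monic (Fct M A) t" "Cod (Fct M A) t = F" for t
  proof -
    have t': "t \<in> Hom (Fct M A) (ndom t) F"
      using t by (simp add: monic_def Hom_Fct_iff)
    obtain u where u: "u \<in> Hom (Fct M A) F (ndom t)"
      using null_object_from[OF F] Fct.Hom_obj[OF t'] by blast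
    have "t \<cdot>\<^bsub>Fct M A\<^esub> u = Id (Fct M A) F"
      using Fct.initial_unique Fct.comp_hom[OF u t'] Fct_id_hom[OF FO] F
      unfolding null_object_def by blast
    then show ?thesis
      using u unfolding factors_through_def by auto
  qed
  ultimately show "F \<in> stably_null M A"
    using FO Fct.monic_Id[of F] unfolding stably_null_def is_subobject_sum_def by auto
qed

lemma null_object_St_iff:
  assumes "abelian_category A"
  shows "null_object (St M A) F \<longleftrightarrow> null_object (Fct M A) F"
proof -
  obtain Z where Z: "null_object A Z"
    using assms unfolding abelian_category_def by blast
  obtain N where N: "null_object (Fct M A) N"
    using null_object_Fct_exists[OF Z] by blast
  show ?thesis
    unfolding stably_null_eq[OF Z]
    by (rule Fct.null_object_quotient_cat[OF N iso_mod_null_Fct[OF assms]])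
qed

section \<open>Comparison of the two families of classes, and their monotonicity\<close>

lemma pol_weak_iff_pol_strong:
  assumes A: "abelian_category A"
  shows "pol_weak M A n F \<longleftrightarrow> pol_strong M A n F"
proof
  have St: "Obj (St M A) = functors M A"
    by (simp add: quotient_cat_def)
  have induced: "fob (induced_functor (Fct M A) (stably_null M A) (delta M A x)) F =
      fob (delta M A x) F" if "F \<in> functors M A" for x F
    using that St by (simp add: induced_functor_def)
  show "pol_weak M A n F \<Longrightarrow> pol_strong M A n F"
  proof (induction rule: pol_weak.induct)
    case (1 n F)
    then show ?case
      using null_object_St_iff[OF A] by (blast intro: pol_strong.intros(1))
  next
    case (2 n F)
    then have F: "F \<in> functors M A"
      using St by simp
    show ?case
    proof (rule pol_strong.intros(2)[OF \<open>n \<ge> 0\<close>])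
      show "F \<in> Obj (Fct M A)"
        using F St by simp
    qed (use "2.IH" induced[OF F] in simp)
  qed
  show "pol_strong M A n F \<Longrightarrow> pol_weak M A n F"
  proof (induction rule: pol_strong.induct)
    case (1 n F)
    then show ?case
      using null_object_St_iff[OF A] by (blast intro: pol_weak.intros(1))
  next
    case (2 n F)
    then have F: "F \<in> functors M A"
      using St by simp
    show ?case
    proof (rule pol_weak.intros(2)[OF \<open>n \<ge> 0\<close>])
      show "F \<in> Obj (St M A)"
        using F St by simp
    qed (use "2.IH" induced[OF F] in simp)
  qed
qed

text \<open>The translate of \<open>F\<close> is null at every object, and a cokernel of an arrow
  into a null object is null. This is what carries null functors from the negative classes into all
  later ones.\<close>

lemma delta_null:
  assumes Z: "null_object A Z" and F: "null_object (Fct M A) F" and x: "x \<in> Obj M"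
  shows "null_object (Fct M A) (fob (delta M A x) F)"
proof -
  have FO: "F \<in> functors M A"
    using null_object_obj[OF F] by simp
  have "null_object (Fct M A) (tau_obj M x F)"
    using null_object_FctI[OF tau_obj_functor[OF FO x]] null_object_FctD[OF Z F] M.oplus_obj[OF x]
    by (simp add: tau_obj_def)
  note cokernel = Fct.cokernel_to_null[OF this shift_map_hom[OF FO x]]
  have "is_cokernel (Fct M A) (shift_map M x F) (delta_proj M A x F)"
    unfolding delta_proj_def using cokernel(1) by (rule someI_ex)
  then show ?thesis
    using cokernel(2) FO by (simp add: delta_def)
qed

lemma pol_strong_null:
  assumes Z: "null_object A Z" and F: "null_object (Fct M A) F"
  shows "pol_strong M A n F"
proof -
  \<comment> \<open>The shift by one starts the induction at index -1, where membership means being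
    null. Smaller indices are covered by the case \<open>n < 0\<close> below.\<close>
  have "pol_strong M A (int k - 1) F" for k
    using F
  proof (induction k arbitrary: F)
    case 0
    then show ?case
      by (auto intro: pol_strong.intros(1))
  next
    case (Suc k)
    then show ?case
      using null_object_obj[OF Suc.prems] delta_null[OF Z Suc.prems]
      by (auto intro: pol_strong.intros(2))
  qed
  from this[of "nat (n + 1)"] F show ?thesis
    by (cases "n < 0") (auto intro: pol_strong.intros(1))
qed

lemma pol_strong_neg_iff:
  "n < 0 \<Longrightarrow> pol_strong M A n F \<longleftrightarrow> null_object (Fct M A) F"
  by (auto intro: pol_strong.intros(1) elim: pol_strong.cases)

text \<open>Applying \<delta> lowers both indices together until \<open>m\<close> is negative; there
  \<open>F\<close> is null and lies in every class. The infima defining the degrees are thus taken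
  over upward closed sets of indices.\<close>

lemma pol_strong_mono:
  assumes Z: "null_object A Z" and "pol_strong M A m F" "m \<le> n"
  shows "pol_strong M A n F"
  using assms(2,3)
proof (induction arbitrary: n rule: pol_strong.induct)
  case (1 m F)
  then show ?case
    using pol_strong_null[OF Z] by blast
next
  case (2 m F)
  show ?case
  proof (rule pol_strong.intros(2))
    show "0 \<le> n" "F \<in> Obj (Fct M A)"
      using 2 by simp_all
    show "pol_strong M A (n - 1) (fob (delta M A x) F)" if "x \<in> Obj M" for x
      using "2.IH"[OF that] "2.prems" by simp
  qed
qed

end


section \<open>Degrees\<close>

text \<open>An infimum is below \<open>n\<close> exactly when some member is, and upward closure
  makes \<open>n - 1\<close> the decisive index. For \<open>n = 0\<close> nothing in
  \<open>enat\<close> lies below, even if \<open>P\<close> holds at -1; hence the condition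
  \<open>0 < n\<close>.\<close>

lemma Inf_enat_less_iff:
  fixes P :: "int \<Rightarrow> bool"
  assumes "\<And>i j. P i \<Longrightarrow> i \<le> j \<Longrightarrow> P j"
  shows "Inf {enat k | k. P (int k)} < enat n \<longleftrightarrow> 0 < n \<and> P (int n - 1)"
proof
  assume "Inf {enat k | k. P (int k)} < enat n"
  then obtain k where "P (int k)" "k < n"
    by (auto simp: Inf_less_iff)
  then show "0 < n \<and> P (int n - 1)"
    using assms by auto
next
  assume n: "0 < n \<and> P (int n - 1)"
  then have "P (int (n - 1))"
    by (simp add: of_nat_diff)
  then show "Inf {enat k | k. P (int k)} < enat n"
    using n by (auto simp: Inf_less_iff intro!: exI[of _ "enat (n - 1)"])
qed

text \<open>Here index -1 counts: at \<open>n = 0\<close> it puts minus infinity into the set. This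
  is the only difference from the criterion in \<open>enat\<close>.\<close>

lemma Inf_ereal_less_iff:
  fixes P :: "int \<Rightarrow> bool"
  assumes mono: "\<And>i j. P i \<Longrightarrow> i \<le> j \<Longrightarrow> P j"
  shows "Inf ({ereal (real k) | k. P (int k)} \<union> {d. d = -\<infinity> \<and> (\<exists>k<0. P k)}) < ereal (real n)
    \<longleftrightarrow> P (int n - 1)" (is "Inf ?D < _ \<longleftrightarrow> _")
proof
  assume "Inf ?D < ereal (real n)"
  then obtain d where "d \<in> ?D" "d < ereal (real n)"
    by (auto simp: Inf_less_iff)
  \<comment> \<open>The member \<open>d\<close> is either a natural number below \<open>n\<close> or
    minus infinity with a negative index; in both cases the index is at most
    \<open>n - 1\<close>.\<close>
  then obtain k where "P k" "k \<le> int n - 1"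
    by force
  then show "P (int n - 1)"
    by (rule mono)
next
  assume *: "P (int n - 1)"
  show "Inf ?D < ereal (real n)"
  proof (cases n)
    case 0
    then have "- \<infinity> \<in> ?D"
      using * by (auto intro!: exI[of _ "-1"])
    moreover have "- \<infinity> < ereal (real n)"
      by simp
    ultimately show ?thesis
      unfolding Inf_less_iff by blast
  next
    case (Suc k)
    then have "ereal (real k) \<in> ?D"
      using * by auto
    moreover have "ereal (real k) < ereal (real n)"
      using Suc by simp
    ultimately show ?thesis
      unfolding Inf_less_iff by blast
  qed
qed

theorem proposition1p23:
  fixes M :: "('o, 'a) moncat" and A :: "('p, 'b) cat" and n :: nat
    and F :: "('o, 'a, 'p, 'b) cfunctor"
  assumes "Mon_nul TYPE('u) M"
    and "grothendieck_category TYPE('u) A"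
    and "F \<in> Obj (Fct M A)"
  shows "((weakly_polynomial M A F \<and> weak_degree M A F \<le> ereal (real n)) \<longleftrightarrow>
          (strongly_polynomial M A F \<and> strong_degree M A F \<le> enat n)) \<and>
         (\<not> (n = 0 \<and> null_object (Fct M A) F) \<longrightarrow>
          ((weakly_polynomial M A F \<and> weak_degree M A F = ereal (real n)) \<longleftrightarrow>
           (strongly_polynomial M A F \<and> strong_degree M A F = enat n)))"
proof -
  have A: "abelian_category A"
    using assms(2) by (simp add: grothendieck_category_def)
  then obtain Z where Z: "null_object A Z"
    unfolding abelian_category_def by blast
  interpret M: strict_symmetric_monoidal M
    using assms(1) by (simp add: Mon_nul_def)
  interpret A: category A
    using A by (simp add: abelian_category_def)
  interpret null_unit_functors M A
    using assms(1) by unfold_locales (simp add: Mon_nul_def)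
  let ?P = "\<lambda>k. pol_strong M A k F"
  have mono: "?P i \<Longrightarrow> i \<le> j \<Longrightarrow> ?P j" for i j
    using pol_strong_mono[OF Z] .
  have image: "fob (quotient_functor (Fct M A) (stably_null M A)) F = F"
    using assms(3) by (simp add: quotient_functor_def)
  have polynomial: "weakly_polynomial M A F \<longleftrightarrow> strongly_polynomial M A F"
    unfolding weakly_polynomial_def strongly_polynomial_def image pol_weak_iff_pol_strong[OF A] ..
  have strong_less: "strong_degree M A F < enat m \<longleftrightarrow> 0 < m \<and> ?P (int m - 1)" for m
    unfolding strong_degree_def using Inf_enat_less_iff[of ?P m] mono by blast
  have weak_less: "weak_degree M A F < ereal (real m) \<longleftrightarrow> ?P (int m - 1)" for m
    unfolding weak_degree_def st_degree_def image pol_weak_iff_pol_strong[OF A]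
    using Inf_ereal_less_iff[of ?P m] mono by blast
  have strong_le: "strong_degree M A F \<le> enat n \<longleftrightarrow> ?P n"
    using strong_less[of "Suc n"] by (cases "strong_degree M A F") auto
  \<comment> \<open>Extended reals leave room between \<open>n\<close> and \<open>Suc n\<close>, so
    only one direction goes through \<open>weak_less\<close>; the other uses that \<open>n\<close>
    itself belongs to the set whose infimum is taken.\<close>
  have weak_le: "weak_degree M A F \<le> ereal (real n) \<longleftrightarrow> ?P n"
  proof
    assume "weak_degree M A F \<le> ereal (real n)"
    also have "\<dots> < ereal (real (Suc n))"
      by simp
    finally show "?P n"
      using weak_less[of "Suc n"] by simp
  next
    assume "?P n"
    then show "weak_degree M A F \<le> ereal (real n)"
      unfolding weak_degree_def st_degree_def image pol_weak_iff_pol_strong[OF A]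
      by (intro Inf_lower) blast
  qed
  \<comment> \<open>Equality is \<open>\<le>\<close> without \<open><\<close>. The resulting
    conditions can differ only at \<open>n = 0\<close>, where index -1 means that \<open>F\<close>
    is null: exactly the excluded case.\<close>
  have "strong_degree M A F = enat n \<longleftrightarrow> ?P n \<and> \<not> (0 < n \<and> ?P (int n - 1))"
    using strong_le strong_less[of n] by (metis leD order.order_iff_strict)
  moreover have "weak_degree M A F = ereal (real n) \<longleftrightarrow> ?P n \<and> \<not> ?P (int n - 1)"
    using weak_le weak_less[of n] by (metis leD order.order_iff_strict)
  moreover have "?P (int n - 1) \<longleftrightarrow> null_object (Fct M A) F" if "n = 0"
    using that pol_strong_neg_iff by simp
  ultimately show ?thesis
    using polynomial strong_le weak_le by auto
qed

end
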